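(* For any positive integers $K$ and $t$ with $t<K$, $(t+1)\nmid K$ and $\lfloor K/2\rfloor<t+1$, there always exists a $\left(K,\ \binom{K}{t}+\binom{K}{t+1},\ \binom{K-1}{t-1}+\binom{K-1}{t+1},\ \binom{K}{t+1}\right)$ SPDA, which gives a $(K,M,N)$ secure coded caching scheme with $\frac{M}{N}=1-\frac{(K-t)(t+1)}{K(K+1)}$, transmission rate $R=\frac{K-t}{K+1}$ and subpacketization $\binom{K}{t}+\binom{K}{t+1}$.
   Context: For a positive integer $n$, $[0,n)=\{0,1,\dots,n-1\}$. SPDA. For positive integers $K,F$, an $F\times K$ array $\mathbf{P}=(p_{j,k})_{j\in[0,F),k\in[0,K)}$ with entries in $\{*\}\cup[0,S)$ is a $(K,F,Z,S)$ secure placement delivery array (SPDA) if: (C1) the symbol $*$ appears exactly $Z$ times in each column; (C2) each $s\in[0,S)$ appears at least four times; (C3) for each $s\in[0,S)$, the subarray $\mathbf{P}^{(s)}$ formed by all rows and columns containing $s$ is, up to row and column permutations, a $(g+1)\times g$ array (for some $g$ depending on $s$) whose first row has all entries equal to $s$ and whose remaining $g$ rows form the $g\times g$ array with $s$ on the diagonal and $*$ off the diagonal. For each $s$, let $\mathcal{U}_s$ be the set of columns containing $s$ and let $j^{(s)}$ be the unique row containing $s$ at least twice. Caching system. A server holds $N$ files $W_0,\dots,W_{N-1}$, independent and uniform on $\{0,1\}^B$ (with $F\mid B$), and serves $K$ users $[0,K)$ over a shared link; each user has a cache for file content of $MB$ bits (the cache space used by keys is not counted). User $k$ requests $W_{d_k}$;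 $\mathbf{d}=(d_0,\dots,d_{K-1})$ is random, independent of everything else, and $\mathbf{d}_{-k}$ is $\mathbf{d}$ with $d_k$ removed. The requested files are assumed to be pairwise different (so $N\ge K$), $\mathbf{d}$ being uniform on such vectors. The scheme given by an SPDA $\mathbf{P}$. The server draws independent uniformly random permutations $\phi_0,\dots,\phi_{N-1}$ of $[0,F)$, known only to itself. Each $W_n$ is split into $F$ packets of $B/F$ bits, the packet in position $j$ carrying the public label $\phi_n(j)$; the labelled packet is written $W_{n,\phi_n(j)}$. User $k$ caches the labelled packets $\mathcal{Z}_k=\{W_{n,\phi_n(j)}: p_{j,k}=*,\ n\in[0,N)\}\cup\{W_{n,\phi_n(j^{(s)})}: p_{j^{(s)},k}=s,\ s\in[0,S),\ n\in[0,N)\}$ and the keys $\mathcal{T}_k=\{T_{\mathcal{U}_s}:k\in\mathcal{U}_s\}$, the keys (one per $s$) being independent and uniform on $\{0,1\}^{B/F}$. Let $\mathfrak{U}_k=\{\mathcal{U}_s:k\in\mathcal{U}_s\}$. For each $s\in[0,S)$ the server broadcasts $T_{\mathcal{U}_s}\oplus X_{\mathcal{U}_s}$, where $$X_{\mathcal{U}_s}=\Big(\bigoplus_{\substack{k\in\mathcal{U}_s,\ j\ne j^{(s)}\\ p_{j,k}=s}}W_{d_k,\phi_{d_k}(j)}\Big)\oplus\Big(\bigoplus_{n\in[0,N)\setminus\{d_k:\,k\in\mathcal{U}_s\}}W_{n,\phi_n(j^{(s)})}\Big),$$ with a header of negligible length giving $\mathcal{U}_s$ and the file indices and labels of the packets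 in $X_{\mathcal{U}_s}$ (in information quantities $X_{\mathcal{U}_s}$ is understood together with this header), and sends $\phi_{d_k}$ privately to user $k$. Such a scheme is a secure coded caching scheme if, for every $k$, $H(W_{d_k}\mid \mathcal{Z}_k,\mathcal{T}_k,\{T_{\mathcal{U}_s}\oplus X_{\mathcal{U}_s}:k\in\mathcal{U}_s\},\phi_{d_k})=0$ (headers included) and $I(\mathbf{d}_{-k};\{X_{\mathcal{U}_s}:k\in\mathcal{U}_s\}\mid\phi_{d_k},\mathcal{Z}_k,d_k,\mathfrak{U}_k)=0$. The rate $R$ is the total number of broadcast bits (excluding headers) divided by $B$; the subpacketization is the number $F$ of packets per file. *)

theory Defs
  imports
    "HOL-Probability.Probability"
    "HOL-Combinatorics.Permutations"
    "HOL-Library.Z2"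
begin

section \<open>Secure placement delivery arrays\<close>

text \<open>Rows are indexed by \<open>j < F\<close> and columns by \<open>k < K\<close>. The symbol \<open>*\<close> is \<^const>\<open>None\<close> and an integer
  \<open>s < S\<close> is \<open>Some s\<close>; values of the array outside this range are irrelevant.\<close>

type_synonym pd_array = "nat \<Rightarrow> nat \<Rightarrow> nat option"

definition rows_with :: "nat \<Rightarrow> nat \<Rightarrow> pd_array \<Rightarrow> nat \<Rightarrow> nat set" where
  "rows_with K F P s = {j. j < F \<and> (\<exists>k<K. P j k = Some s)}"

definition users :: "nat \<Rightarrow> nat \<Rightarrow> pd_array \<Rightarrow> nat \<Rightarrow> nat set" where
  "users K F P s = {k. k < K \<and> (\<exists>j<F. P j k = Some s)}"

text \<open>In the last clause, \<open>r\<close> and \<open>c\<close> enumerate the rows and columns of the subarray in the permuted order.\<close>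

definition spda :: "nat \<Rightarrow> nat \<Rightarrow> nat \<Rightarrow> nat \<Rightarrow> pd_array \<Rightarrow> bool" where
  "spda K F Z S P \<longleftrightarrow>
     0 < K \<and> 0 < F \<and>
     (\<forall>j<F. \<forall>k<K. \<forall>s. P j k = Some s \<longrightarrow> s < S) \<and>
     (\<forall>k<K. card {j. j < F \<and> P j k = None} = Z) \<and>
     (\<forall>s<S. 4 \<le> card {(j, k). j < F \<and> k < K \<and> P j k = Some s}) \<and>
     (\<forall>s<S. \<exists>(g::nat) r c.
        bij_betw r {..<g + 1} (rows_with K F P s) \<and>
        bij_betw c {..<g} (users K F P s) \<and>
        (\<forall>l<g. P (r 0) (c l) = Some s) \<and>
        (\<forall>i<g. \<forall>l<g. P (r (i + 1)) (c l) = (if i = l then Some s else None)))"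

text \<open>For an SPDA, the row in which \<open>s\<close> occurs at least twice is unique.\<close>

definition main_row :: "nat \<Rightarrow> nat \<Rightarrow> pd_array \<Rightarrow> nat \<Rightarrow> nat" where
  "main_row K F P s = (THE j. j < F \<and> 2 \<le> card {k. k < K \<and> P j k = Some s})"


section \<open>Bit strings\<close>

type_synonym bits = "bit list"

definition bit_strings :: "nat \<Rightarrow> bits set" where
  "bit_strings n = {w. length w = n}"

text \<open>Addition in \<^typ>\<open>bit\<close> is exclusive or.\<close>

definition xor_family :: "nat \<Rightarrow> ('i \<Rightarrow> bits) \<Rightarrow> 'i set \<Rightarrow> bits" where
  "xor_family b f A = map (\<lambda>i. \<Sum>a\<in>A. f a ! i) [0..<b]"

definition xor_bits :: "bits \<Rightarrow> bits \<Rightarrow> bits" where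
  "xor_bits v w = map2 (+) v w"


section \<open>The caching scheme given by an array\<close>

text \<open>An outcome \<open>(W, d, \<phi>, T)\<close> consists of the files, the demands, the permutations and the keys.
  A labelled packet is a triple of file index, label and content.\<close>

type_synonym outcome =
  "(nat \<Rightarrow> bits) \<times> (nat \<Rightarrow> nat) \<times> (nat \<Rightarrow> nat \<Rightarrow> nat) \<times> (nat \<Rightarrow> bits)"
type_synonym labelled_packet = "nat \<times> nat \<times> bits"

text \<open>A multicast message: the header (a user group and the file indices and labels of the packets
  involved) and the payload.\<close>

type_synonym message = "nat set \<times> (nat \<times> nat) set \<times> bits"

context
  fixes K N B F S :: nat and P :: pd_array
begin

definition packet :: "bits \<Rightarrow> nat \<Rightarrow> bits" where
  "packet w j = take (B div F) (drop (j * (B div F)) w)"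

text \<open>The uniform distribution on a product of finite sets: the four components are independent, and
  so are the individual files, permutations and keys.\<close>

definition outcomes :: "outcome set" where
  "outcomes =
     ({..<N} \<rightarrow>\<^sub>E bit_strings B) \<times>
     {d \<in> {..<K} \<rightarrow>\<^sub>E {..<N}. inj_on d {..<K}} \<times>
     ({..<N} \<rightarrow>\<^sub>E {\<pi>. \<pi> permutes {..<F}}) \<times>
     ({..<S} \<rightarrow>\<^sub>E bit_strings (B div F))"

definition caching_space :: "outcome measure" where
  "caching_space = uniform_count_measure outcomes"

definition labelled :: "outcome \<Rightarrow> nat \<Rightarrow> nat \<Rightarrow> labelled_packet" where
  "labelled = (\<lambda>(W, d, \<phi>, T) n j. (n, \<phi> n j, packet (W n) j))"

definition cache :: "nat \<Rightarrow> outcome \<Rightarrow> labelled_packet set" where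
  "cache k \<omega> =
     {labelled \<omega> n j |n j. n < N \<and> j < F \<and> P j k = None} \<union>
     {labelled \<omega> n (main_row K F P s) |n s. n < N \<and> s < S \<and> P (main_row K F P s) k = Some s}"

definition multicasts_of :: "nat \<Rightarrow> nat set" where
  "multicasts_of k = {s. s < S \<and> k \<in> users K F P s}"

text \<open>The keys and transmissions of a user are families indexed by \<open>s\<close>, because distinct \<open>s\<close> may
  have the same set of users.\<close>

definition keys :: "nat \<Rightarrow> outcome \<Rightarrow> nat \<Rightarrow> bits" where
  "keys k = (\<lambda>(W, d, \<phi>, T). restrict T (multicasts_of k))"

definition user_groups :: "nat \<Rightarrow> nat set set" where
  "user_groups k = users K F P ` multicasts_of k"

definition wanted_positions :: "nat \<Rightarrow> (nat \<times> nat) set" where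
  "wanted_positions s =
     {(k, j). k \<in> users K F P s \<and> j < F \<and> j \<noteq> main_row K F P s \<and> P j k = Some s}"

definition other_files :: "nat \<Rightarrow> outcome \<Rightarrow> nat set" where
  "other_files s = (\<lambda>(W, d, \<phi>, T). {..<N} - d ` users K F P s)"

definition header :: "nat \<Rightarrow> outcome \<Rightarrow> (nat \<times> nat) set" where
  "header s = (\<lambda>(W, d, \<phi>, T).
     (\<lambda>(k, j). (d k, \<phi> (d k) j)) ` wanted_positions s \<union>
     (\<lambda>n. (n, \<phi> n (main_row K F P s))) ` other_files s (W, d, \<phi>, T))"

definition payload :: "nat \<Rightarrow> outcome \<Rightarrow> bits" where
  "payload s = (\<lambda>(W, d, \<phi>, T).
     xor_bits
       (xor_family (B div F) (\<lambda>(k, j). packet (W (d k)) j) (wanted_positions s))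
       (xor_family (B div F) (\<lambda>n. packet (W n) (main_row K F P s)) (other_files s (W, d, \<phi>, T))))"

definition plain_message :: "nat \<Rightarrow> outcome \<Rightarrow> message" where
  "plain_message s \<omega> = (users K F P s, header s \<omega>, payload s \<omega>)"

definition encrypted_payload :: "nat \<Rightarrow> outcome \<Rightarrow> bits" where
  "encrypted_payload s = (\<lambda>(W, d, \<phi>, T). xor_bits (T s) (payload s (W, d, \<phi>, T)))"

definition broadcast :: "nat \<Rightarrow> outcome \<Rightarrow> message" where
  "broadcast s \<omega> = (users K F P s, header s \<omega>, encrypted_payload s \<omega>)"

definition plain_messages :: "nat \<Rightarrow> outcome \<Rightarrow> nat \<Rightarrow> message" where
  "plain_messages k \<omega> = (\<lambda>s\<in>multicasts_of k. plain_message s \<omega>)"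

definition broadcasts :: "nat \<Rightarrow> outcome \<Rightarrow> nat \<Rightarrow> message" where
  "broadcasts k \<omega> = (\<lambda>s\<in>multicasts_of k. broadcast s \<omega>)"

definition demand :: "nat \<Rightarrow> outcome \<Rightarrow> nat" where
  "demand k = (\<lambda>(W, d, \<phi>, T). d k)"

definition other_demands :: "nat \<Rightarrow> outcome \<Rightarrow> nat \<Rightarrow> nat" where
  "other_demands k = (\<lambda>(W, d, \<phi>, T). restrict d ({..<K} - {k}))"

definition demanded_file :: "nat \<Rightarrow> outcome \<Rightarrow> bits" where
  "demanded_file k = (\<lambda>(W, d, \<phi>, T). W (d k))"

definition demanded_perm :: "nat \<Rightarrow> outcome \<Rightarrow> nat \<Rightarrow> nat" where
  "demanded_perm k = (\<lambda>(W, d, \<phi>, T). \<phi> (d k))"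

text \<open>Entropies of discrete random variables on the scheme's probability space; these are the
  notations \<open>\<H>(X | Y)\<close> and \<open>\<I>(X ; Y | Z)\<close> of the locale \<^locale>\<open>information_space\<close>, in bits.\<close>

abbreviation cond_entropy :: "(outcome \<Rightarrow> 'x) \<Rightarrow> (outcome \<Rightarrow> 'y) \<Rightarrow> real" where
  "cond_entropy X Y \<equiv> prob_space.conditional_entropy caching_space 2
     (count_space (X ` space caching_space)) (count_space (Y ` space caching_space)) X Y"

abbreviation cond_mutual_info ::
  "(outcome \<Rightarrow> 'x) \<Rightarrow> (outcome \<Rightarrow> 'y) \<Rightarrow> (outcome \<Rightarrow> 'z) \<Rightarrow> real" where
  "cond_mutual_info X Y Z \<equiv> prob_space.conditional_mutual_information caching_space 2
     (count_space (X ` space caching_space)) (count_space (Y ` space caching_space))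
     (count_space (Z ` space caching_space)) X Y Z"

definition secure_coded_caching :: bool where
  "secure_coded_caching \<longleftrightarrow>
     (\<forall>k<K.
        cond_entropy (demanded_file k)
          (\<lambda>\<omega>. (cache k \<omega>, keys k \<omega>, broadcasts k \<omega>, demanded_perm k \<omega>)) = 0 \<and>
        cond_mutual_info (other_demands k) (plain_messages k)
          (\<lambda>\<omega>. (demanded_perm k \<omega>, cache k \<omega>, demand k \<omega>, user_groups k)) = 0)"

text \<open>Cached file content is counted in bits of packet contents; keys and labels are not counted.\<close>

definition cache_bits :: "nat \<Rightarrow> outcome \<Rightarrow> nat" where
  "cache_bits k \<omega> = (\<Sum>(n, l, w)\<in>cache k \<omega>. length w)"

definition memory_size :: "real \<Rightarrow> bool" where
  "memory_size M \<longleftrightarrow> (\<forall>\<omega>\<in>outcomes. \<forall>k<K. real (cache_bits k \<omega>) = M * real B)"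

definition transmission_rate :: "real \<Rightarrow> bool" where
  "transmission_rate R \<longleftrightarrow>
     (\<forall>\<omega>\<in>outcomes. R = real (\<Sum>s<S. length (encrypted_payload s \<omega>)) / real B)"

end

text \<open>\<open>P\<close> has \<open>F\<close> rows, so \<open>F\<close> is the subpacketization of the scheme.\<close>

definition gives_scheme ::
  "nat \<Rightarrow> nat \<Rightarrow> nat \<Rightarrow> nat \<Rightarrow> nat \<Rightarrow> pd_array \<Rightarrow> real \<Rightarrow> real \<Rightarrow> bool" where
  "gives_scheme K N B F S P M R \<longleftrightarrow>
     secure_coded_caching K N B F S P \<and>
     memory_size K N B F S P M \<and>
     transmission_rate K N B F S P R"

end

theory Submission
  imports Defs
begin

text \<open>
  Index the rows by the \<open>t\<close>-subsets and the \<open>(t + 1)\<close>-subsets of the users and the symbols by the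
  \<open>(t + 1)\<close>-subsets. In column \<open>k\<close>, a \<open>t\<close>-subset \<open>A\<close> carries \<open>*\<close> if \<open>k \<in> A\<close> and the symbol
  \<open>A \<union> {k}\<close> otherwise; a \<open>(t + 1)\<close>-subset carries itself if it contains \<open>k\<close>, and \<open>*\<close> otherwise.

  The scheme of any SPDA with \<open>Z < F\<close> is secure. Each message to user \<open>k\<close> contains one packet of
  every file, and all of them but the one of file \<open>d k\<close> are cached by \<open>k\<close>. Moreover, for a fixed
  file the messages to \<open>k\<close> use distinct rows. So, when the other demands change, a suitable
  permutation of the cached rows of each file \<open>n \<noteq> d k\<close>, applied both to the packets of \<open>n\<close> and to
  \<open>\<phi> n\<close>, maps the new rows to the old ones. It leaves the labelled packets, hence the cache and
  the messages of \<open>k\<close>, unchanged. This is a measure-preserving transport between any two values of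
  the other demands.
\<close>

section \<open>Entropy of functions of a uniform outcome\<close>

locale uniform_finite =
  fixes \<Omega> :: "'a set"
  assumes finite_outcomes: "finite \<Omega>" and outcomes_nonempty: "\<Omega> \<noteq> {}"
begin

abbreviation "M \<equiv> uniform_count_measure \<Omega>"

definition freq :: "('a \<Rightarrow> 'b) \<Rightarrow> 'b \<Rightarrow> real" where
  "freq X x = card {\<omega> \<in> \<Omega>. X \<omega> = x} / card \<Omega>"

sublocale information_space M 2
  by (simp add: information_space_def information_space_axioms_def
      prob_space_uniform_count_measure finite_outcomes outcomes_nonempty)

lemma simple_distributed_freq: "simple_distributed M X (freq X)"
proof (rule simple_distributedI)
  show "simple_function M X"
    by (auto simp: simple_function_def space_uniform_count_measure sets_uniform_count_measure
        finite_outcomes)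
  show "freq X x = measure M (X -` {x} \<inter> space M)" for x
    by (simp add: freq_def measure_uniform_count_measure finite_outcomes space_uniform_count_measure
        Int_def vimage_def conj_commute)
qed (simp add: freq_def)

lemma freq_pos: "\<omega> \<in> \<Omega> \<Longrightarrow> 0 < freq X (X \<omega>)"
  using finite_outcomes by (auto simp: freq_def card_gt_0_iff intro!: divide_pos_pos)

text \<open>\<open>Y\<close> determines \<open>X\<close>, so each joint atom has the frequency of
  its \<open>Y\<close>-atom, and every logarithm in the entropy sum is log 1.\<close>

lemma conditional_entropy_eq_0:
  assumes "\<And>\<omega> \<omega>'. \<omega> \<in> \<Omega> \<Longrightarrow> \<omega>' \<in> \<Omega> \<Longrightarrow> Y \<omega> = Y \<omega>' \<Longrightarrow> X \<omega> = X \<omega>'"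
  shows "conditional_entropy 2 (count_space (X ` space M)) (count_space (Y ` space M)) X Y = 0"
proof -
  have "freq (\<lambda>\<omega>. (X \<omega>, Y \<omega>)) (X \<omega>, Y \<omega>) = freq Y (Y \<omega>)" if "\<omega> \<in> \<Omega>" for \<omega>
  proof -
    have "{\<eta> \<in> \<Omega>. (X \<eta>, Y \<eta>) = (X \<omega>, Y \<omega>)} = {\<eta> \<in> \<Omega>. Y \<eta> = Y \<omega>}"
      using that by (auto intro: assms)
    then show ?thesis
      by (simp only: freq_def)
  qed
  moreover have "freq Y (Y \<omega>) \<noteq> 0" if "\<omega> \<in> \<Omega>" for \<omega>
    using freq_pos[OF that, of Y] by simp
  ultimately show ?thesis
    by (subst conditional_entropy_eq[OF simple_distributed_freq simple_distributed_freq])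
      (auto simp: space_uniform_count_measure intro!: sum.neutral)
qed

text \<open>The maps provided by \<open>transport\<close> show that, conditionally on \<open>Z\<close>, every value of \<open>X\<close> is equally
  likely and the law of \<open>Y\<close> does not depend on \<open>X\<close>.\<close>

lemma conditional_mutual_information_eq_0:
  assumes transport: "\<And>\<omega> \<omega>'. \<omega> \<in> \<Omega> \<Longrightarrow> \<omega>' \<in> \<Omega> \<Longrightarrow> Z \<omega> = Z \<omega>' \<Longrightarrow>
    \<exists>f. inj_on f {\<eta> \<in> \<Omega>. X \<eta> = X \<omega> \<and> Z \<eta> = Z \<omega>} \<and>
      (\<forall>\<eta> \<in> \<Omega>. X \<eta> = X \<omega> \<and> Z \<eta> = Z \<omega> \<longrightarrow>
        f \<eta> \<in> \<Omega> \<and> X (f \<eta>) = X \<omega>' \<and> Y (f \<eta>) = Y \<eta> \<and> Z (f \<eta>) = Z \<omega>)"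
  shows "conditional_mutual_information 2
    (count_space (X ` space M)) (count_space (Y ` space M)) (count_space (Z ` space M)) X Y Z = 0"
proof -
  define n where "n P = card {\<eta> \<in> \<Omega>. P \<eta>}" for P
  have fin: "finite {\<eta> \<in> \<Omega>. P \<eta>}" for P
    using finite_outcomes by simp
  \<comment> \<open>The predicate \<open>Q\<close> lets one argument serve both the pair of
    \<open>X\<close> and \<open>Z\<close> and the triple with \<open>Y\<close>. Injectivity yields
    only an inequality; exchanging the two outcomes reverses it.\<close>
  have le: "n (\<lambda>\<eta>. X \<eta> = X \<omega> \<and> Q (Y \<eta>) \<and> Z \<eta> = Z \<omega>) \<le> n (\<lambda>\<eta>. X \<eta> = X \<omega>' \<and> Q (Y \<eta>) \<and> Z \<eta> = Z \<omega>)"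
    if \<omega>: "\<omega> \<in> \<Omega>" "\<omega>' \<in> \<Omega>" "Z \<omega> = Z \<omega>'" for \<omega> \<omega>' Q
  proof -
    obtain f where f: "inj_on f {\<eta> \<in> \<Omega>. X \<eta> = X \<omega> \<and> Z \<eta> = Z \<omega>}"
      and *: "\<And>\<eta>. \<eta> \<in> \<Omega> \<Longrightarrow> X \<eta> = X \<omega> \<Longrightarrow> Z \<eta> = Z \<omega> \<Longrightarrow>
        f \<eta> \<in> \<Omega> \<and> X (f \<eta>) = X \<omega>' \<and> Y (f \<eta>) = Y \<eta> \<and> Z (f \<eta>) = Z \<omega>"
      using transport[OF \<omega>] by blast
    have "inj_on f {\<eta> \<in> \<Omega>. X \<eta> = X \<omega> \<and> Q (Y \<eta>) \<and> Z \<eta> = Z \<omega>}"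
      by (rule inj_on_subset[OF f]) auto
    then show ?thesis
      unfolding n_def by (rule card_inj_on_le) (use * fin in auto)
  qed
  have eq: "n (\<lambda>\<eta>. X \<eta> = X \<omega> \<and> Q (Y \<eta>) \<and> Z \<eta> = Z \<omega>) = n (\<lambda>\<eta>. X \<eta> = X \<omega>' \<and> Q (Y \<eta>) \<and> Z \<eta> = Z \<omega>)"
    if "\<omega> \<in> \<Omega>" "\<omega>' \<in> \<Omega>" "Z \<omega>' = Z \<omega>" for \<omega> \<omega>' Q
    using le[of \<omega> \<omega>' Q] le[of \<omega>' \<omega> Q] that by simp
  \<comment> \<open>The event is split by the value of \<open>X\<close>, and all classes have the
    same size by \<open>eq\<close>. The factor does not depend on \<open>Q\<close>, so it cancels
    when two instances are compared below.\<close>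
  have total: "n (\<lambda>\<eta>. Q (Y \<eta>) \<and> Z \<eta> = Z \<omega>) =
      card (X ` {\<eta> \<in> \<Omega>. Z \<eta> = Z \<omega>}) * n (\<lambda>\<eta>. X \<eta> = X \<omega> \<and> Q (Y \<eta>) \<and> Z \<eta> = Z \<omega>)"
    if "\<omega> \<in> \<Omega>" for \<omega> Q
  proof -
    have "{\<eta> \<in> \<Omega>. Q (Y \<eta>) \<and> Z \<eta> = Z \<omega>} =
        (\<Union>x\<in>X ` {\<eta> \<in> \<Omega>. Z \<eta> = Z \<omega>}. {\<eta> \<in> \<Omega>. X \<eta> = x \<and> Q (Y \<eta>) \<and> Z \<eta> = Z \<omega>})"
      by auto
    then have "n (\<lambda>\<eta>. Q (Y \<eta>) \<and> Z \<eta> = Z \<omega>) =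
        (\<Sum>x\<in>X ` {\<eta> \<in> \<Omega>. Z \<eta> = Z \<omega>}. n (\<lambda>\<eta>. X \<eta> = x \<and> Q (Y \<eta>) \<and> Z \<eta> = Z \<omega>))"
      unfolding n_def by (simp only:) (rule card_UN_disjoint, use fin in auto)
    also have "\<dots> = (\<Sum>x\<in>X ` {\<eta> \<in> \<Omega>. Z \<eta> = Z \<omega>}. n (\<lambda>\<eta>. X \<eta> = X \<omega> \<and> Q (Y \<eta>) \<and> Z \<eta> = Z \<omega>))"
      using eq[OF that] by (intro sum.cong) auto
    finally show ?thesis by simp
  qed
  have "freq (\<lambda>\<eta>. (X \<eta>, Y \<eta>, Z \<eta>)) (X \<omega>, Y \<omega>, Z \<omega>) /
      (freq (\<lambda>\<eta>. (X \<eta>, Z \<eta>)) (X \<omega>, Z \<omega>) * (freq (\<lambda>\<eta>. (Y \<eta>, Z \<eta>)) (Y \<omega>, Z \<omega>) / freq Z (Z \<omega>))) = 1"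
    if \<omega>: "\<omega> \<in> \<Omega>" for \<omega>
  proof -
    have ratio: "a / (b * (c / d)) = 1" if "a * d = b * c" "0 < b" "0 < c" "0 < d" for a b c d :: real
      using that by (simp add: field_simps)
    show ?thesis
    proof (rule ratio)
      show "freq (\<lambda>\<eta>. (X \<eta>, Y \<eta>, Z \<eta>)) (X \<omega>, Y \<omega>, Z \<omega>) * freq Z (Z \<omega>) =
          freq (\<lambda>\<eta>. (X \<eta>, Z \<eta>)) (X \<omega>, Z \<omega>) * freq (\<lambda>\<eta>. (Y \<eta>, Z \<eta>)) (Y \<omega>, Z \<omega>)"
        using total[OF \<omega>, of "\<lambda>_. True"] total[OF \<omega>, of "\<lambda>y. y = Y \<omega>"]
        by (simp add: freq_def n_def)
    qed (rule freq_pos[OF \<omega>])+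
  qed
  then have "freq (\<lambda>\<eta>. (X \<eta>, Y \<eta>, Z \<eta>)) (X \<omega>, Y \<omega>, Z \<omega>) *
      log 2 (freq (\<lambda>\<eta>. (X \<eta>, Y \<eta>, Z \<eta>)) (X \<omega>, Y \<omega>, Z \<omega>) /
        (freq (\<lambda>\<eta>. (X \<eta>, Z \<eta>)) (X \<omega>, Z \<omega>) *
          (freq (\<lambda>\<eta>. (Y \<eta>, Z \<eta>)) (Y \<omega>, Z \<omega>) / freq Z (Z \<omega>)))) = 0"
    if "\<omega> \<in> \<Omega>" for \<omega>
    using that by (simp only: log_one mult_zero_right)
  then have "(\<Sum>(x, y, z)\<in>(\<lambda>\<eta>. (X \<eta>, Y \<eta>, Z \<eta>)) ` \<Omega>. freq (\<lambda>\<eta>. (X \<eta>, Y \<eta>, Z \<eta>)) (x, y, z) *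
      log 2 (freq (\<lambda>\<eta>. (X \<eta>, Y \<eta>, Z \<eta>)) (x, y, z) / (freq (\<lambda>\<eta>. (X \<eta>, Z \<eta>)) (x, z) *
          (freq (\<lambda>\<eta>. (Y \<eta>, Z \<eta>)) (y, z) / freq Z z)))) = 0"
    by (intro sum.neutral ballI) (elim imageE, simp only: prod.case)
  then show ?thesis
    using conditional_mutual_information_eq[OF simple_distributed_freq simple_distributed_freq
            simple_distributed_freq simple_distributed_freq, of X Y Z]
    by (simp only: space_uniform_count_measure)
qed

end

section \<open>Placement delivery arrays and the rows sent\<close>

text \<open>The images of \<open>f\<close> and \<open>g\<close> have equally many elements, hence so
  do their complements in \<open>J\<close>; any bijection between the complements completes the map
  from \<open>f a\<close> to \<open>g a\<close>.\<close>

lemma permutation_extending: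
  assumes "finite J" "inj_on f A" "inj_on g A" "f ` A \<subseteq> J" "g ` A \<subseteq> J"
  obtains \<rho> where "\<rho> permutes J" "\<And>a. a \<in> A \<Longrightarrow> \<rho> (f a) = g a"
proof -
  have "finite A"
    using assms by (meson finite_imageD finite_subset)
  have "card (J - f ` A) = card (J - g ` A)"
    using assms \<open>finite A\<close> by (simp add: card_Diff_subset card_image)
  then obtain h where h: "bij_betw h (J - f ` A) (J - g ` A)"
    using assms(1) by (meson finite_Diff finite_same_card_bij)
  define \<rho> where "\<rho> x = (if x \<in> f ` A then g (the_inv_into A f x) else if x \<in> J then h x else x)" for x
  have "bij_betw (\<lambda>x. g (the_inv_into A f x)) (f ` A) (g ` A)"
    using bij_betw_trans[OF bij_betw_the_inv_into[OF inj_on_imp_bij_betw[OF assms(2)]]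
        inj_on_imp_bij_betw[OF assms(3)]] by (simp add: comp_def)
  then have "bij_betw \<rho> (f ` A) (g ` A)"
    by (rule bij_betw_cong[THEN iffD1, rotated]) (simp add: \<rho>_def)
  moreover have "bij_betw \<rho> (J - f ` A) (J - g ` A)"
    using h by (rule bij_betw_cong[THEN iffD1, rotated]) (simp add: \<rho>_def)
  ultimately have "bij_betw \<rho> (f ` A \<union> (J - f ` A)) (g ` A \<union> (J - g ` A))"
    by (rule bij_betw_combine) auto
  then have "bij_betw \<rho> J J"
    using assms by (simp add: Un_absorb1)
  then have "\<rho> permutes J"
    by (rule bij_imp_permutes) (use assms in \<open>auto simp: \<rho>_def\<close>)
  then show thesis
    by (rule that) (simp add: \<rho>_def the_inv_into_f_f assms)
qed

section \<open>The subarray of one symbol\<close>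

locale spda_array =
  fixes K F Z S :: nat and P :: pd_array
  assumes spda: "spda K F Z S P"
begin

text \<open>\<open>m\<close> is the full row of the permuted subarray and \<open>q k\<close> the
  diagonal row of column \<open>k\<close>. Each column holds \<open>s\<close> at most twice, so the
  required four occurrences force at least two columns.\<close>

lemma symbolE:
  assumes "s < S"
  obtains m q where "m < F"
    and "\<And>k. k \<in> users K F P s \<Longrightarrow> P m k = Some s"
    and "\<And>k. k \<in> users K F P s \<Longrightarrow> q k < F \<and> q k \<noteq> m \<and> P (q k) k = Some s"
    and "\<And>k i. k \<in> users K F P s \<Longrightarrow> i \<in> users K F P s \<Longrightarrow> i \<noteq> k \<Longrightarrow> P (q k) i = None"
    and "\<And>j k. j < F \<Longrightarrow> k < K \<Longrightarrow> P j k = Some s \<Longrightarrow> j = m \<or> j = q k"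
    and "2 \<le> card (users K F P s)"
proof -
  let ?U = "users K F P s" and ?R = "rows_with K F P s"
  obtain g r c where r: "bij_betw r {..<g + 1::nat} ?R" and c: "bij_betw c {..<g} ?U"
    and main: "\<forall>l<g. P (r 0) (c l) = Some s"
    and diag: "\<forall>i<g. \<forall>l<g. P (r (i + 1)) (c l) = (if i = l then Some s else None)"
    using spda assms unfolding spda_def by blast
  define l where "l = the_inv_into {..<g} c"
  have l: "l k < g" "c (l k) = k" if "k \<in> ?U" for k
    using that c bij_betw_the_inv_into[OF c] f_the_inv_into_f_bij_betw[OF c, of k]
    by (auto simp: l_def bij_betw_def)
  have r_F: "r i < F" if "i < g + 1" for i
    using bij_betwE[OF r] that by (auto simp: rows_with_def)
  have inj_r: "r i = r j \<longleftrightarrow> i = j" if "i < g + 1" "j < g + 1" for i j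
    using r that by (auto simp: bij_betw_def inj_on_def)
  define m where "m = r 0"
  define q where "q k = r (l k + 1)" for k
  have 1: "P m k = Some s" if "k \<in> ?U" for k
    using main l[OF that] by (metis m_def)
  have 2: "q k < F \<and> q k \<noteq> m \<and> P (q k) k = Some s" if "k \<in> ?U" for k
    using diag l[OF that] r_F[of "l k + 1"] inj_r[of "l k + 1" 0] by (simp add: q_def m_def) metis
  have 3: "P (q k) i = None" if "k \<in> ?U" "i \<in> ?U" "i \<noteq> k" for k i
    using diag l[OF that(1)] l[OF that(2)] that(3) unfolding q_def by metis
  have 4: "j = m \<or> j = q k" if "j < F" "k < K" "P j k = Some s" for j k
  proof -
    have "j \<in> ?R" and k: "k \<in> ?U"
      using that by (auto simp: rows_with_def users_def)
    \<comment> \<open>Index 0 is the full row, a positive index \<open>a\<close> the diagonal row of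
      column \<open>c (a - 1)\<close>.\<close>
    then obtain a where "a < g + 1" "j = r a"
      using r by (auto simp: bij_betw_def)
    then show ?thesis
      using diag[rule_format, of "a - 1" "l k"] l[OF k] that(3)
      by (cases a) (auto simp: m_def q_def split: if_splits)
  qed
  have fin: "finite ?U"
    by (simp add: users_def)
  have "{(j, k). j < F \<and> k < K \<and> P j k = Some s} \<subseteq> (\<lambda>k. (m, k)) ` ?U \<union> (\<lambda>k. (q k, k)) ` ?U"
  proof safe
    fix j k assume j: "j < F" "k < K" "P j k = Some s" "(j, k) \<notin> (\<lambda>k. (q k, k)) ` ?U"
    then have "k \<in> ?U"
      by (auto simp: users_def)
    then show "(j, k) \<in> Pair m ` ?U"
      using 4[OF j(1-3)] j(4) by auto
  qed
  then have "card {(j, k). j < F \<and> k < K \<and> P j k = Some s}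
      \<le> card ((\<lambda>k. (m, k)) ` ?U \<union> (\<lambda>k. (q k, k)) ` ?U)"
    by (rule card_mono[rotated]) (simp add: fin)
  also have "\<dots> \<le> card ?U + card ?U"
    by (meson add_mono card_Un_le card_image_le fin order.trans)
  finally have "4 \<le> card ?U + card ?U"
    using spda assms unfolding spda_def by (meson order.trans)
  then have 5: "2 \<le> card ?U"
    by simp
  show thesis
    by (rule that[of m q]) (use 1 2 3 4 5 r_F[of 0] in \<open>auto simp: m_def\<close>)
qed

abbreviation U :: "nat \<Rightarrow> nat set" where
  "U \<equiv> users K F P"

abbreviation main :: "nat \<Rightarrow> nat" where
  "main \<equiv> main_row K F P"

text \<open>This is the diagonal row of column \<open>k\<close> in the subarray of \<open>s\<close>:
  the row of the packet that user \<open>k\<close> learns from message \<open>s\<close>.\<close>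

definition wanted_row :: "nat \<Rightarrow> nat \<Rightarrow> nat" where
  "wanted_row s k = (THE j. j < F \<and> j \<noteq> main s \<and> P j k = Some s)"

text \<open>Identifies \<open>main\<close> and \<open>wanted_row\<close> with \<open>m\<close> and
  \<open>q\<close> of \<open>symbolE\<close>. A row with \<open>s\<close> in two columns must be the
  full one, since a diagonal row has \<open>*\<close> in every other column of
  \<open>s\<close>.\<close>

lemma
  assumes "s < S"
  shows main_less: "main s < F"
    and main_entry: "k \<in> U s \<Longrightarrow> P (main s) k = Some s"
    and wanted_row_less: "k \<in> U s \<Longrightarrow> wanted_row s k < F"
    and wanted_row_neq_main: "k \<in> U s \<Longrightarrow> wanted_row s k \<noteq> main s"
    and wanted_row_entry: "k \<in> U s \<Longrightarrow> P (wanted_row s k) k = Some s"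
    and wanted_row_None: "k \<in> U s \<Longrightarrow> i \<in> U s \<Longrightarrow> i \<noteq> k \<Longrightarrow> P (wanted_row s k) i = None"
    and row_cases: "j < F \<Longrightarrow> k < K \<Longrightarrow> P j k = Some s \<Longrightarrow> j = main s \<or> j = wanted_row s k"
proof -
  obtain m q where m: "m < F" "\<And>k. k \<in> U s \<Longrightarrow> P m k = Some s"
    and q: "\<And>k. k \<in> U s \<Longrightarrow> q k < F \<and> q k \<noteq> m \<and> P (q k) k = Some s"
    and None: "\<And>k i. k \<in> U s \<Longrightarrow> i \<in> U s \<Longrightarrow> i \<noteq> k \<Longrightarrow> P (q k) i = None"
    and cases: "\<And>j k. j < F \<Longrightarrow> k < K \<Longrightarrow> P j k = Some s \<Longrightarrow> j = m \<or> j = q k"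
    and card: "2 \<le> card (U s)"
    using symbolE[OF assms] by blast
  have U_K: "k < K" if "k \<in> U s" for k
    using that by (simp add: users_def)
  have main: "main s = m"
    unfolding main_row_def
  proof (rule the_equality)
    have "{k. k < K \<and> P m k = Some s} = U s"
      using m by (auto simp: users_def)
    then show "m < F \<and> 2 \<le> card {k. k < K \<and> P m k = Some s}"
      using m card by simp
    fix j assume j: "j < F \<and> 2 \<le> card {k. k < K \<and> P j k = Some s}"
    then obtain k i where ki: "k \<noteq> i" "k < K" "i < K" "P j k = Some s" "P j i = Some s"
      using card_le_Suc0_iff_eq[of "{k. k < K \<and> P j k = Some s}"] by fastforce
    then have "k \<in> U s" "i \<in> U s"
      using j by (auto simp: users_def)
    then show "j = m"
      using cases[of j k] None[of k i] ki j by auto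
  qed
  have wanted: "wanted_row s k = q k" if "k \<in> U s" for k
    unfolding wanted_row_def main using q[OF that] cases[OF _ U_K[OF that]] by (intro the_equality) auto
  show "main s < F" "k \<in> U s \<Longrightarrow> P (main s) k = Some s"
    using m main by auto
  show "k \<in> U s \<Longrightarrow> wanted_row s k < F" "k \<in> U s \<Longrightarrow> wanted_row s k \<noteq> main s"
    "k \<in> U s \<Longrightarrow> P (wanted_row s k) k = Some s"
    "k \<in> U s \<Longrightarrow> i \<in> U s \<Longrightarrow> i \<noteq> k \<Longrightarrow> P (wanted_row s k) i = None"
    using q None main wanted by auto
  show "j < F \<Longrightarrow> k < K \<Longrightarrow> P j k = Some s \<Longrightarrow> j = main s \<or> j = wanted_row s k"
  proof -
    assume j: "j < F" "k < K" "P j k = Some s"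
    then have "k \<in> U s"
      by (auto simp: users_def)
    then show ?thesis
      using cases[OF j] main wanted by simp
  qed
qed

section \<open>Rows cached by a user\<close>

lemma F_pos: "0 < F"
  using spda by (simp add: spda_def)

lemma symbol_less: "j < F \<Longrightarrow> k < K \<Longrightarrow> P j k = Some s \<Longrightarrow> s < S"
  using spda by (auto simp: spda_def)

lemma in_multicasts_of: "s \<in> multicasts_of K F S P k \<longleftrightarrow> s < S \<and> k \<in> U s"
  by (simp add: multicasts_of_def)

lemma finite_multicasts_of: "finite (multicasts_of K F S P k)"
  by (simp add: multicasts_of_def)

text \<open>A \<open>*\<close> satisfies the condition vacuously, so both kinds of cached packets
  are covered. The rows are the same for every file.\<close>

definition cached_rows :: "nat \<Rightarrow> nat set" where
  "cached_rows k = {j. j < F \<and> (\<forall>s. P j k = Some s \<longrightarrow> j = main s)}"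

lemma finite_cached_rows: "finite (cached_rows k)"
  by (simp add: cached_rows_def)

lemma wanted_row_notin_cached:
  "s < S \<Longrightarrow> k \<in> U s \<Longrightarrow> wanted_row s k \<notin> cached_rows k"
  using wanted_row_entry wanted_row_neq_main by (auto simp: cached_rows_def)

text \<open>What the cache of \<open>k\<close> lacks is delivered, one row per message. This serves
  both the counting of cached rows and the decoding.\<close>

lemma cached_row_cases:
  assumes "j < F" "k < K"
  obtains "j \<in> cached_rows k" | s where "s \<in> multicasts_of K F S P k" "j = wanted_row s k"
proof (cases "\<exists>s. P j k = Some s \<and> j \<noteq> main s")
  case True
  then obtain s where s: "P j k = Some s" "j \<noteq> main s"
    by blast
  then have "s \<in> multicasts_of K F S P k" "j = wanted_row s k"
    using assms symbol_less[OF assms s(1)] row_cases[OF symbol_less[OF assms s(1)] assms s(1)]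
    by (auto simp: in_multicasts_of users_def)
  then show thesis
    by (rule that(2))
qed (use assms that(1) in \<open>auto simp: cached_rows_def\<close>)

text \<open>If m messages go to \<open>k\<close>, the cache holds \<open>Z\<close> rows with
  \<open>*\<close> and m main rows, and the uncached rows are the m wanted ones. Eliminating m from
  these two counts gives the equation.\<close>

lemma cached_rows_card:
  assumes "k < K"
  shows "2 * card (cached_rows k) = F + Z"
proof -
  let ?s = "multicasts_of K F S P k"
  \<comment> \<open>The entry of column \<open>k\<close> in either kind of row is \<open>s\<close>
    itself, so the row determines the message.\<close>
  have wanted: "inj_on (\<lambda>s. wanted_row s k) ?s"
    by (rule inj_onI) (metis in_multicasts_of option.inject wanted_row_entry)
  have main: "inj_on main ?s"
    by (rule inj_onI) (metis in_multicasts_of option.inject main_entry)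
  have N: "card {j. j < F \<and> P j k = None} = Z"
    using spda assms by (simp add: spda_def)
  have C: "cached_rows k = {j. j < F \<and> P j k = None} \<union> main ` ?s"
  proof (intro equalityI subsetI)
    fix j assume j: "j \<in> cached_rows k"
    show "j \<in> {j. j < F \<and> P j k = None} \<union> main ` ?s"
    proof (cases "P j k")
      case (Some s)
      then have "s \<in> ?s" "j = main s"
        using j assms symbol_less[of j k s]
        by (auto simp: cached_rows_def in_multicasts_of users_def)
      then show ?thesis by blast
    qed (use j in \<open>simp add: cached_rows_def\<close>)
  next
    fix j assume "j \<in> {j. j < F \<and> P j k = None} \<union> main ` ?s"
    then show "j \<in> cached_rows k"
      using main_entry main_less by (auto simp: cached_rows_def in_multicasts_of)
  qed
  have "card (cached_rows k) = Z + card ?s"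
    unfolding C by (subst card_Un_disjoint)
      (use N main main_entry finite_multicasts_of in
        \<open>auto simp: card_image in_multicasts_of\<close>)
  moreover have "{..<F} = cached_rows k \<union> (\<lambda>s. wanted_row s k) ` ?s"
    using assms wanted_row_less by (auto elim: cached_row_cases simp: cached_rows_def in_multicasts_of)
  then have "F = card (cached_rows k \<union> (\<lambda>s. wanted_row s k) ` ?s)"
    by (metis card_lessThan)
  then have "F = card (cached_rows k) + card ?s"
    using wanted_row_notin_cached[of _ k]
    by (subst (asm) card_Un_disjoint)
      (auto simp: wanted card_image finite_multicasts_of finite_cached_rows in_multicasts_of)
  ultimately show ?thesis by simp
qed

text \<open>Decoding needs some header from which to read off the demand; \<open>Z < F\<close>
  ensures that column \<open>k\<close> is not all \<open>*\<close>.\<close>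

lemma multicasts_of_nonempty:
  assumes "k < K" "Z < F"
  shows "multicasts_of K F S P k \<noteq> {}"
proof
  assume "multicasts_of K F S P k = {}"
  then have "P j k = None" if "j < F" for j
    using that assms symbol_less[of j k] by (cases "P j k") (auto simp: multicasts_of_def users_def)
  then have "{j. j < F \<and> P j k = None} = {..<F}"
    by auto
  then show False
    using spda assms by (auto simp: spda_def)
qed

section \<open>The row of each file used in a message\<close>

text \<open>Since demands are distinct, message \<open>s\<close> involves exactly one row of every file.\<close>

definition sent_row :: "nat \<Rightarrow> (nat \<Rightarrow> nat) \<Rightarrow> nat \<Rightarrow> nat" where
  "sent_row s d n = (if n \<in> d ` U s then wanted_row s (the_inv_into (U s) d n) else main s)"

lemma sent_row_demand: "inj_on d (U s) \<Longrightarrow> k \<in> U s \<Longrightarrow> sent_row s d (d k) = wanted_row s k"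
  by (simp add: sent_row_def the_inv_into_f_f)

lemma U_subset: "U s \<subseteq> {..<K}"
  by (auto simp: users_def)

lemma inj_on_U: "inj_on d {..<K} \<Longrightarrow> inj_on d (U s)"
  by (erule inj_on_subset) (rule U_subset)

lemma sent_row_cases:
  assumes "inj_on d {..<K}"
  obtains k where "k \<in> U s" "n = d k" "sent_row s d n = wanted_row s k"
  | "n \<notin> d ` U s" "sent_row s d n = main s"
  using assms sent_row_demand[OF inj_on_U] by (cases "n \<in> d ` U s") (auto simp: sent_row_def)

lemma sent_row_less: "inj_on d {..<K} \<Longrightarrow> s < S \<Longrightarrow> sent_row s d n < F"
  by (rule sent_row_cases[of d s n]) (auto simp: main_less wanted_row_less)

text \<open>If another user \<open>i\<close> of the group demands \<open>n\<close>, the row sent is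
  the wanted row of \<open>i\<close>, which has \<open>*\<close> in column \<open>k\<close>. If
  nobody in the group does, it is the main row, which \<open>k\<close> caches as well.\<close>

lemma sent_row_cached:
  assumes "inj_on d {..<K}" "s \<in> multicasts_of K F S P k" "n \<noteq> d k"
  shows "sent_row s d n \<in> cached_rows k"
  using assms(1)
proof (cases rule: sent_row_cases[of d s n])
  case (1 i)
  then have "P (wanted_row s i) k = None" "wanted_row s i < F"
    using assms wanted_row_None[of s i k] wanted_row_less[of s i]
    by (auto simp: in_multicasts_of)
  then show ?thesis
    using 1 by (simp add: cached_rows_def)
next
  case 2
  then show ?thesis
    using assms main_entry[of s k] main_less[of s] by (auto simp: cached_rows_def in_multicasts_of)
qed

text \<open>This makes the rows used for file \<open>n\<close> extendable to a permutation. Two main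
  rows are told apart by column \<open>k\<close>; two wanted rows belong to the same user, by
  distinct demands, and are told apart by that user's column.\<close>

lemma inj_on_sent_row:
  assumes d: "inj_on d {..<K}"
  shows "inj_on (\<lambda>s. sent_row s d n) (multicasts_of K F S P k)"
proof (rule inj_onI)
  fix s s' assume s: "s \<in> multicasts_of K F S P k" "s' \<in> multicasts_of K F S P k"
    and eq: "sent_row s d n = sent_row s' d n"
  then have sS: "s < S" "s' < S" and k: "k \<in> U s" "k \<in> U s'"
    by (auto simp: in_multicasts_of)
  \<comment> \<open>In column \<open>k\<close> the main row shows its symbol. A wanted row of
    another user has \<open>*\<close> there; that of \<open>k\<close> itself shows its own symbol
    but is not the main row of that symbol.\<close>
  have main_wanted: "main r \<noteq> wanted_row r' i" if "r < S" "r' < S" "k \<in> U r" "k \<in> U r'" "i \<in> U r'"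
    for r r' i
  proof (cases "i = k")
    case True
    show ?thesis
    proof
      assume "main r = wanted_row r' i"
      with True that have "r = r'"
        by (metis main_entry wanted_row_entry option.inject)
      then show False
        using that \<open>main r = wanted_row r' i\<close> wanted_row_neq_main by metis
    qed
  next
    case False
    then show ?thesis
      using that by (metis main_entry wanted_row_None option.distinct(1))
  qed
  show "s = s'"
    using d
  proof (cases rule: sent_row_cases[of d s n])
    case i: (1 i)
    show ?thesis using d
    proof (cases rule: sent_row_cases[of d s' n])
      case j: (1 j)
      have "i \<in> {..<K}" "j \<in> {..<K}"
        using i j U_subset by auto
      then have "i = j"
        using d i j by (metis inj_onD)
      then show ?thesis
        using i j eq sS by (metis wanted_row_entry option.inject)
    next
      case 2
      then show ?thesis
        using i eq main_wanted[of s' s i] sS k by metis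
    qed
  next
    case m: 2
    show ?thesis using d
    proof (cases rule: sent_row_cases[of d s' n])
      case (1 j)
      then show ?thesis
        using m eq main_wanted[of s s' j] sS k by metis
    next
      case 2
      then show ?thesis
        using m eq sS k by (metis main_entry option.inject)
    qed
  qed
qed

end

section \<open>Security of the scheme\<close>

lemma xor_bits_nth: "length v = b \<Longrightarrow> length w = b \<Longrightarrow> i < b \<Longrightarrow> xor_bits v w ! i = v ! i + w ! i"
  by (simp add: xor_bits_def)

lemma length_xor_bits: "length (xor_bits v w) = min (length v) (length w)"
  by (simp add: xor_bits_def)

lemma length_xor_family: "length (xor_family b f A) = b"
  by (simp add: xor_family_def)

lemma xor_family_nth: "i < b \<Longrightarrow> xor_family b f A ! i = (\<Sum>a\<in>A. f a ! i)"
  by (simp add: xor_family_def)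

lemma xor_bits_left_cancel:
  assumes "xor_bits u v = xor_bits u w" "length v = length u" "length w = length u"
  shows "v = w"
proof (rule nth_equalityI)
  fix i assume "i < length v"
  then have "u ! i + v ! i = u ! i + w ! i"
    using assms by (metis xor_bits_nth)
  then show "v ! i = w ! i"
    by (rule add_left_imp_eq)
qed (use assms in simp)

lemma restrict_eqD: "restrict f A = restrict g A \<Longrightarrow> x \<in> A \<Longrightarrow> f x = g x"
  by (drule fun_cong[of _ _ x]) simp

section \<open>The probability space of the scheme\<close>

locale spda_scheme = spda_array +
  fixes N B :: nat
  assumes enough_files: "K \<le> N" and B_pos: "0 < B" and F_dvd_B: "F dvd B"
begin

abbreviation b :: nat where "b \<equiv> B div F"

lemma F_b: "F * b = B"
  using F_dvd_B by simp

lemma b_pos: "0 < b"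
  using F_b B_pos by (cases b) auto

lemma outcomes_iff:
  "(W, d, \<phi>, T) \<in> outcomes K N B F S \<longleftrightarrow>
    W \<in> {..<N} \<rightarrow>\<^sub>E bit_strings B \<and> d \<in> {..<K} \<rightarrow>\<^sub>E {..<N} \<and> inj_on d {..<K} \<and>
    \<phi> \<in> {..<N} \<rightarrow>\<^sub>E {\<pi>. \<pi> permutes {..<F}} \<and> T \<in> {..<S} \<rightarrow>\<^sub>E bit_strings b"
  by (auto simp: outcomes_def)

lemma outcomesD:
  assumes "(W, d, \<phi>, T) \<in> outcomes K N B F S"
  shows "n < N \<Longrightarrow> length (W n) = B" and "k < K \<Longrightarrow> d k < N" and "inj_on d {..<K}"
    and "n < N \<Longrightarrow> \<phi> n permutes {..<F}" and "s < S \<Longrightarrow> length (T s) = b"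
  using assms by (auto simp: outcomes_iff bit_strings_def)

lemma finite_bit_strings: "finite (bit_strings n)"
proof -
  have "(UNIV :: bit set) = {0, 1}"
    using bit_not_zero_iff by blast
  then have "finite (UNIV :: bit set)"
    by (metis finite.emptyI finite.insertI)
  then show ?thesis
    using finite_lists_length_eq[of "UNIV :: bit set" n] by (simp add: bit_strings_def)
qed

sublocale uniform_finite "outcomes K N B F S"
proof
  show "finite (outcomes K N B F S)"
    unfolding outcomes_def
    by (intro finite_cartesian_product finite_PiE finite_bit_strings finite_permutations)
      (auto intro: finite_subset[OF _ finite_PiE[of "{..<K}" "\<lambda>_. {..<N}"]])
  \<comment> \<open>Witness: zero files and keys, identity permutations, and user \<open>k\<close>
    demanding file \<open>k\<close>, which exists because \<open>K \<le> N\<close>.\<close>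
  have "((\<lambda>n\<in>{..<N}. replicate B 0), (\<lambda>k\<in>{..<K}. k), (\<lambda>n\<in>{..<N}. id),
      (\<lambda>s\<in>{..<S}. replicate b 0)) \<in> outcomes K N B F S"
    using enough_files by (auto simp: outcomes_iff bit_strings_def permutes_id inj_on_def)
  then show "outcomes K N B F S \<noteq> {}"
    by blast
qed

section \<open>Packets and their rearrangement\<close>

lemma length_packet:
  assumes "length w = B" "j < F"
  shows "length (packet B F w j) = b"
proof -
  have "Suc j * b \<le> F * b"
    using assms by (intro mult_le_mono1) simp
  then show ?thesis
    using assms F_b by (simp add: packet_def)
qed

lemma packet_nth:
  assumes "length w = B" "j < F" "i < b"
  shows "packet B F w j ! i = w ! (j * b + i)"
  using length_packet[OF assms(1,2)] assms F_b by (simp add: packet_def)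

lemma position:
  assumes "x < B"
  shows "x div b < F" "x mod b < b" "x div b * b + x mod b = x"
  using assms b_pos F_b by (simp_all only: less_mult_imp_div_less mod_less_divisor div_mult_mod_eq)

lemma eq_if_packets_eq:
  assumes "length w = B" "length w' = B" "\<And>j. j < F \<Longrightarrow> packet B F w j = packet B F w' j"
  shows "w = w'"
proof (rule nth_equalityI)
  fix x assume "x < length w"
  then have x: "x < B"
    using assms by simp
  show "w ! x = w' ! x"
    using assms(3)[OF position(1)[OF x]] packet_nth[OF assms(1) position(1,2)[OF x]]
      packet_nth[OF assms(2) position(1,2)[OF x]] position(3)[OF x] by simp
qed (use assms in simp)

text \<open>Moves whole packets: position \<open>j * b + i\<close> is read from packet
  \<open>\<rho> j\<close> at the same offset \<open>i\<close>. It is the counterpart on contents of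
  composing the labels with \<open>\<rho>\<close>.\<close>

definition rearrange :: "(nat \<Rightarrow> nat) \<Rightarrow> bits \<Rightarrow> bits" where
  "rearrange \<rho> w = map (\<lambda>x. w ! (\<rho> (x div b) * b + x mod b)) [0..<B]"

lemma length_rearrange: "length (rearrange \<rho> w) = B"
  by (simp add: rearrange_def)

lemma packet_rearrange:
  assumes "\<rho> permutes {..<F}" "length w = B" "j < F"
  shows "packet B F (rearrange \<rho> w) j = packet B F w (\<rho> j)"
proof (rule nth_equalityI)
  have \<rho>: "\<rho> j < F"
    using assms permutes_in_image[of \<rho> "{..<F}" j] by simp
  show "length (packet B F (rearrange \<rho> w) j) = length (packet B F w (\<rho> j))"
    by (simp add: length_packet length_rearrange assms \<rho>)
  fix i assume "i < length (packet B F (rearrange \<rho> w) j)"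
  then have i: "i < b"
    by (simp add: length_packet length_rearrange assms)
  have "j * b + i < Suc j * b"
    using i by simp
  also have "\<dots> \<le> F * b"
    using assms by (intro mult_le_mono1) simp
  finally have "j * b + i < B"
    using F_b by simp
  then show "packet B F (rearrange \<rho> w) j ! i = packet B F w (\<rho> j) ! i"
    using i by (simp add: packet_nth length_rearrange assms \<rho> rearrange_def)
qed

text \<open>\<open>\<rho>\<close> is onto, so every packet of the file survives in the
  rearrangement.\<close>

lemma rearrange_inject:
  assumes "\<rho> permutes {..<F}" "length w = B" "length w' = B" "rearrange \<rho> w = rearrange \<rho> w'"
  shows "w = w'"
proof (rule eq_if_packets_eq[OF assms(2,3)])
  fix j assume "j < F"
  then obtain i where "i < F" "j = \<rho> i"
    using permutes_image[OF assms(1)] by (metis imageE lessThan_iff)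
  then show "packet B F w j = packet B F w' j"
    using packet_rearrange[OF assms(1)] assms by metis
qed

section \<open>Messages in terms of sent rows\<close>

lemma wanted_positions_eq:
  assumes "s < S"
  shows "wanted_positions K F P s = (\<lambda>k. (k, wanted_row s k)) ` U s"
proof (intro equalityI subsetI)
  fix x assume "x \<in> wanted_positions K F P s"
  then obtain k j where x: "x = (k, j)" "k \<in> U s" "j < F" "j \<noteq> main s" "P j k = Some s"
    by (auto simp: wanted_positions_def)
  moreover from this have "k < K"
    by (simp add: users_def)
  ultimately show "x \<in> (\<lambda>k. (k, wanted_row s k)) ` U s"
    using row_cases[OF assms, of j k] by auto
next
  fix x assume "x \<in> (\<lambda>k. (k, wanted_row s k)) ` U s"
  then show "x \<in> wanted_positions K F P s"
    using wanted_row_less wanted_row_neq_main wanted_row_entry assms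
    by (auto simp: wanted_positions_def)
qed

lemma demands_split:
  assumes "(W, d, \<phi>, T) \<in> outcomes K N B F S"
  shows "{..<N} = d ` U s \<union> other_files K N F P s (W, d, \<phi>, T)"
  using outcomesD(2)[OF assms] by (auto simp: other_files_def users_def)

text \<open>\<open>sent_row\<close> merges the demanded and the remaining files into one family over
  all \<open>N\<close> files. The demands then affect a message only through the rows used.\<close>

lemma header_eq:
  assumes \<omega>: "(W, d, \<phi>, T) \<in> outcomes K N B F S" and s: "s < S"
  shows "header K N F P s (W, d, \<phi>, T) = (\<lambda>n. (n, \<phi> n (sent_row s d n))) ` {..<N}"
proof -
  have "(\<lambda>(k, j). (d k, \<phi> (d k) j)) ` wanted_positions K F P s =
      (\<lambda>n. (n, \<phi> n (sent_row s d n))) ` d ` U s"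
    using sent_row_demand[OF inj_on_U[OF outcomesD(3)[OF \<omega>]], of _ s]
    by (auto simp: wanted_positions_eq[OF s] image_image cong: image_cong_simp)
  moreover have "(\<lambda>n. (n, \<phi> n (main s))) ` other_files K N F P s (W, d, \<phi>, T) =
      (\<lambda>n. (n, \<phi> n (sent_row s d n))) ` other_files K N F P s (W, d, \<phi>, T)"
    by (auto simp: other_files_def sent_row_def)
  ultimately show ?thesis
    unfolding header_def demands_split[OF \<omega>, of s] image_Un by simp
qed

text \<open>The same merging for the sum: demands are distinct within the group, so a sum over its
  users is a sum over their files, and the other files make up the rest.\<close>

lemma payload_eq:
  assumes \<omega>: "(W, d, \<phi>, T) \<in> outcomes K N B F S" and s: "s < S"
  shows "payload K N B F P s (W, d, \<phi>, T) =
    xor_family b (\<lambda>n. packet B F (W n) (sent_row s d n)) {..<N}"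
proof (rule nth_equalityI)
  let ?o = "other_files K N F P s (W, d, \<phi>, T)"
  have d: "inj_on d (U s)"
    by (rule inj_on_U[OF outcomesD(3)[OF \<omega>]])
  show "length (payload K N B F P s (W, d, \<phi>, T)) =
      length (xor_family b (\<lambda>n. packet B F (W n) (sent_row s d n)) {..<N})"
    by (simp add: payload_def length_xor_bits length_xor_family)
  fix i assume "i < length (payload K N B F P s (W, d, \<phi>, T))"
  then have i: "i < b"
    by (simp add: payload_def length_xor_bits length_xor_family)
  have "(\<Sum>(k, j)\<in>wanted_positions K F P s. packet B F (W (d k)) j ! i) =
      (\<Sum>k\<in>U s. packet B F (W (d k)) (wanted_row s k) ! i)"
    unfolding wanted_positions_eq[OF s] by (subst sum.reindex) (auto simp: inj_on_def)
  also have "\<dots> = (\<Sum>n\<in>d ` U s. packet B F (W n) (sent_row s d n) ! i)"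
    by (subst sum.reindex[OF d]) (simp add: sent_row_demand[OF d])
  finally have 1: "(\<Sum>(k, j)\<in>wanted_positions K F P s. packet B F (W (d k)) j ! i) =
    (\<Sum>n\<in>d ` U s. packet B F (W n) (sent_row s d n) ! i)" .
  have 2: "(\<Sum>n\<in>?o. packet B F (W n) (main s) ! i) = (\<Sum>n\<in>?o. packet B F (W n) (sent_row s d n) ! i)"
    by (intro sum.cong) (auto simp: other_files_def sent_row_def)
  have "(\<Sum>n<N. packet B F (W n) (sent_row s d n) ! i) =
      (\<Sum>n\<in>d ` U s. packet B F (W n) (sent_row s d n) ! i) +
      (\<Sum>n\<in>?o. packet B F (W n) (sent_row s d n) ! i)"
    unfolding demands_split[OF \<omega>, of s]
    by (rule sum.union_disjoint) (auto simp: other_files_def users_def)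
  moreover have "payload K N B F P s (W, d, \<phi>, T) ! i =
      (\<Sum>(k, j)\<in>wanted_positions K F P s. packet B F (W (d k)) j ! i) +
      (\<Sum>n\<in>?o. packet B F (W n) (main s) ! i)"
    unfolding payload_def prod.case xor_bits_nth[OF length_xor_family length_xor_family i]
      xor_family_nth[OF i] by (simp only: split_def)
  ultimately show "payload K N B F P s (W, d, \<phi>, T) ! i =
      xor_family b (\<lambda>n. packet B F (W n) (sent_row s d n)) {..<N} ! i"
    by (simp only: xor_family_nth[OF i] 1 2)
qed

lemma length_payload:
  "(W, d, \<phi>, T) \<in> outcomes K N B F S \<Longrightarrow> s < S \<Longrightarrow> length (payload K N B F P s (W, d, \<phi>, T)) = b"
  by (simp add: payload_eq length_xor_family)

section \<open>Cache contents, memory and rate\<close>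

lemma cache_eq:
  "cache K N B F S P k (W, d, \<phi>, T) =
    (\<lambda>(n, j). (n, \<phi> n j, packet B F (W n) j)) ` ({..<N} \<times> cached_rows k)" if "k < K"
proof (intro equalityI subsetI)
  fix x assume "x \<in> cache K N B F S P k (W, d, \<phi>, T)"
  then obtain n j where "x = labelled B F (W, d, \<phi>, T) n j" "n < N" "j \<in> cached_rows k"
    unfolding cache_def using main_less by (auto simp: cached_rows_def)
  then show "x \<in> (\<lambda>(n, j). (n, \<phi> n j, packet B F (W n) j)) ` ({..<N} \<times> cached_rows k)"
    by (auto simp: labelled_def)
next
  fix x assume "x \<in> (\<lambda>(n, j). (n, \<phi> n j, packet B F (W n) j)) ` ({..<N} \<times> cached_rows k)"
  then obtain n j where x: "x = labelled B F (W, d, \<phi>, T) n j" "n < N" "j \<in> cached_rows k"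
    by (auto simp: labelled_def)
  show "x \<in> cache K N B F S P k (W, d, \<phi>, T)"
  proof (cases "P j k")
    case None
    with x show ?thesis
      unfolding cache_def by (auto simp: cached_rows_def)
  next
    case (Some s)
    with x have "j = main s" "s < S" "P (main s) k = Some s"
      using symbol_less[of j k s] that by (auto simp: cached_rows_def)
    with x show ?thesis
      unfolding cache_def by auto
  qed
qed

text \<open>Each of the \<open>N\<close> files contributes its cached rows at \<open>b\<close> bits
  each; by \<open>cached_rows_card\<close> the total is half of
  \<open>N * (F + Z) * b\<close>.\<close>

lemma memory: "memory_size K N B F S P (real N * real (F + Z) / real (2 * F))"
  unfolding memory_size_def
proof (intro ballI allI impI)
  fix \<omega> k assume \<omega>: "\<omega> \<in> outcomes K N B F S" and k: "k < K"
  obtain W d \<phi> T where \<omega>_eq: "\<omega> = (W, d, \<phi>, T)"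
    by (cases \<omega>)
  note D = outcomesD[OF \<omega>[unfolded \<omega>_eq]]
  \<comment> \<open>Packets of one file carry distinct labels, so packets with equal contents do not
    collapse in the cache set.\<close>
  have "inj_on (\<lambda>(n, j). (n, \<phi> n j, packet B F (W n) j)) ({..<N} \<times> cached_rows k)"
    using inj_eq[OF permutes_inj[OF D(4)]] by (clarsimp simp: inj_on_def)
  then have "cache_bits K N B F S P k \<omega> =
      (\<Sum>(n, j)\<in>{..<N} \<times> cached_rows k. length (packet B F (W n) j))"
    unfolding cache_bits_def \<omega>_eq cache_eq[OF k] by (subst sum.reindex) (auto intro: sum.cong)
  also have "\<dots> = (\<Sum>(n, j)\<in>{..<N} \<times> cached_rows k. b)"
    using D(1) by (intro sum.cong) (auto simp: length_packet cached_rows_def)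
  also have "\<dots> = N * card (cached_rows k) * b"
    by (simp add: split_def card_cartesian_product)
  finally have "2 * cache_bits K N B F S P k \<omega> = N * (F + Z) * b"
    unfolding cached_rows_card[OF k, symmetric] by simp
  then have "2 * real (cache_bits K N B F S P k \<omega>) = real N * real (F + Z) * real b"
    by (metis of_nat_mult of_nat_numeral)
  moreover have "real B = real F * real b"
    using F_b by (metis of_nat_mult)
  ultimately show "real (cache_bits K N B F S P k \<omega>) = real N * real (F + Z) / real (2 * F) * real B"
    using F_pos by (simp add: field_simps)
qed

text \<open>Each of the \<open>S\<close> encrypted payloads has the length \<open>B div F\<close> of
  one packet.\<close>

lemma rate: "transmission_rate K N B F S P (real S / real F)"
  unfolding transmission_rate_def
proof
  fix \<omega> assume \<omega>: "\<omega> \<in> outcomes K N B F S"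
  have "length (encrypted_payload K N B F P s \<omega>) = b" if "s < S" for s
    using \<omega> that outcomesD(5) length_payload
    by (cases \<omega>) (auto simp: encrypted_payload_def length_xor_bits)
  then have "(\<Sum>s<S. length (encrypted_payload K N B F P s \<omega>)) = S * b"
    by simp
  moreover have "real B = real F * real b"
    using F_b by (metis of_nat_mult)
  ultimately show "real S / real F = real (\<Sum>s<S. length (encrypted_payload K N B F P s \<omega>)) / real B"
    using F_pos b_pos by simp
qed

section \<open>Decoding\<close>

text \<open>The user is not told its own demand: it is the only file whose packet listed in a header is
  not cached.\<close>

lemma decode:
  assumes Z: "Z < F" and k: "k < K"
    and \<omega>: "(W, d, \<phi>, T) \<in> outcomes K N B F S" and \<omega>': "(W', d', \<phi>', T') \<in> outcomes K N B F S"
    and cache: "cache K N B F S P k (W, d, \<phi>, T) = cache K N B F S P k (W', d', \<phi>', T')"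
    and T_eq: "\<And>s. s \<in> multicasts_of K F S P k \<Longrightarrow> T s = T' s"
    and header: "\<And>s. s \<in> multicasts_of K F S P k \<Longrightarrow>
      header K N F P s (W, d, \<phi>, T) = header K N F P s (W', d', \<phi>', T')"
    and encrypted: "\<And>s. s \<in> multicasts_of K F S P k \<Longrightarrow>
      encrypted_payload K N B F P s (W, d, \<phi>, T) = encrypted_payload K N B F P s (W', d', \<phi>', T')"
    and perm: "\<phi> (d k) = \<phi>' (d' k)"
  shows "W (d k) = W' (d' k)"
proof -
  note D = outcomesD[OF \<omega>] and D' = outcomesD[OF \<omega>']
  \<comment> \<open>A header lists one label for each file index, so equality of the sets is
    equality file by file.\<close>
  have header_sent: "\<phi> n (sent_row s d n) = \<phi>' n (sent_row s d' n)"
    if s: "s \<in> multicasts_of K F S P k" and n: "n < N" for s n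
  proof -
    have sS: "s < S"
      using s by (simp add: in_multicasts_of)
    have "(n, \<phi> n (sent_row s d n)) \<in> header K N F P s (W, d, \<phi>, T)"
      using n by (simp add: header_eq[OF \<omega> sS])
    then have "(n, \<phi> n (sent_row s d n)) \<in> header K N F P s (W', d', \<phi>', T')"
      by (simp only: header[OF s])
    then show ?thesis
      unfolding header_eq[OF \<omega>' sS] by blast
  qed
  have cached: "\<exists>j'\<in>cached_rows k. \<phi> n j = \<phi>' n j' \<and> packet B F (W n) j = packet B F (W' n) j'"
    if "n < N" "j \<in> cached_rows k" for n j
  proof -
    have "(n, \<phi> n j, packet B F (W n) j) \<in> cache K N B F S P k (W, d, \<phi>, T)"
      using that by (auto simp: cache_eq[OF k])
    then have "(n, \<phi> n j, packet B F (W n) j) \<in> cache K N B F S P k (W', d', \<phi>', T')"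
      by (simp only: cache)
    then show ?thesis
      unfolding cache_eq[OF k] by auto
  qed
  \<comment> \<open>The matching cache entry of the second outcome bears the label of row
    \<open>j'\<close>; labels are injective, so it comes from row \<open>j'\<close>.\<close>
  have cached_packet: "j' \<in> cached_rows k \<and> packet B F (W n) j = packet B F (W' n) j'"
    if n: "n < N" and "j \<in> cached_rows k" "\<phi> n j = \<phi>' n j'" for n j j'
    using cached[OF that(1,2)] that(3) inj_eq[OF permutes_inj[OF D'(4)[OF n]]] by metis
  have "d' k = d k"
  proof (rule ccontr)
    assume neq: "d' k \<noteq> d k"
    obtain s where s: "s \<in> multicasts_of K F S P k"
      using multicasts_of_nonempty[OF k Z] by blast
    then have sS: "s < S" "k \<in> U s"
      by (auto simp: in_multicasts_of)
    \<comment> \<open>In the first outcome file \<open>d' k\<close> is not the one demanded by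
      \<open>k\<close>, so its packet in message \<open>s\<close> is cached. Equal caches and
      headers make it cached in the second outcome too, where it lies in the wanted row of
      \<open>k\<close>.\<close>
    have "sent_row s d (d' k) \<in> cached_rows k"
      by (rule sent_row_cached[OF D(3) s neq])
    then have "sent_row s d' (d' k) \<in> cached_rows k"
      using cached_packet header_sent[OF s] D'(2)[OF k] by metis
    then show False
      using sent_row_demand[OF inj_on_U[OF D'(3)] sS(2)] wanted_row_notin_cached[OF sS] by simp
  qed
  define m where "m = d k"
  have m: "d k = m" "d' k = m" "m < N"
    using \<open>d' k = d k\<close> D(2)[OF k] by (auto simp: m_def)
  have \<phi>: "\<phi> m = \<phi>' m"
    using perm m by simp
  have "W m = W' m"
  proof (rule eq_if_packets_eq)
    fix j assume "j < F"
    from this k show "packet B F (W m) j = packet B F (W' m) j"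
    proof (cases rule: cached_row_cases)
      \<comment> \<open>Equal permutations of file \<open>m\<close> allow
        \<open>cached_packet\<close> with the same row \<open>j\<close> on both sides.\<close>
      case 1
      then show ?thesis
        using cached_packet[OF m(3)] \<phi> by metis
    next
      case (2 s)
      then have s: "s < S" "k \<in> U s"
        by (auto simp: in_multicasts_of)
      have j: "sent_row s d m = j" "sent_row s d' m = j"
        using 2 m sent_row_demand[OF inj_on_U[OF D(3)] s(2)] sent_row_demand[OF inj_on_U[OF D'(3)] s(2)]
        by auto
      have "payload K N B F P s (W, d, \<phi>, T) = payload K N B F P s (W', d', \<phi>', T')"
      proof (rule xor_bits_left_cancel)
        show "xor_bits (T s) (payload K N B F P s (W, d, \<phi>, T)) =
            xor_bits (T s) (payload K N B F P s (W', d', \<phi>', T'))"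
          using encrypted[OF 2(1)] T_eq[OF 2(1)] by (simp add: encrypted_payload_def)
      qed (simp_all add: length_payload[OF \<omega> s(1)] length_payload[OF \<omega>' s(1)] D(5)[OF s(1)])
      then have payload: "xor_family b (\<lambda>n. packet B F (W n) (sent_row s d n)) {..<N} =
          xor_family b (\<lambda>n. packet B F (W' n) (sent_row s d' n)) {..<N}"
        by (simp only: payload_eq[OF \<omega> s(1)] payload_eq[OF \<omega>' s(1)])
      show ?thesis
      proof (rule nth_equalityI)
        fix i assume "i < length (packet B F (W m) j)"
        then have i: "i < b"
          using D(1) m(3) \<open>j < F\<close> by (simp add: length_packet)
        \<comment> \<open>All summands other than that of \<open>m\<close> are cached packets, hence
          agree and cancel from the equal payloads.\<close>
        have others: "packet B F (W n) (sent_row s d n) = packet B F (W' n) (sent_row s d' n)"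
          if "n \<in> {..<N} - {m}" for n
          using cached_packet[OF _ sent_row_cached[OF D(3) 2(1)] header_sent[OF 2(1)]] that m by auto
        have sum_eq: "(\<Sum>n<N. packet B F (W n) (sent_row s d n) ! i) =
            (\<Sum>n<N. packet B F (W' n) (sent_row s d' n) ! i)"
          using payload i by (metis xor_family_nth)
        have "packet B F (W m) j ! i + (\<Sum>n\<in>{..<N} - {m}. packet B F (W n) (sent_row s d n) ! i) =
            packet B F (W' m) j ! i + (\<Sum>n\<in>{..<N} - {m}. packet B F (W' n) (sent_row s d' n) ! i)"
          using sum_eq m(3) by (simp only: sum.remove[of "{..<N}" m] finite_lessThan lessThan_iff j)
        also have "(\<Sum>n\<in>{..<N} - {m}. packet B F (W' n) (sent_row s d' n) ! i) =
            (\<Sum>n\<in>{..<N} - {m}. packet B F (W n) (sent_row s d n) ! i)"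
          by (intro sum.cong) (simp_all only: others)
        finally show "packet B F (W m) j ! i = packet B F (W' m) j ! i"
          by (rule add_right_imp_eq)
      qed (use D(1) D'(1) m(3) \<open>j < F\<close> in \<open>simp add: length_packet\<close>)
    qed
  qed (use D(1) D'(1) m in auto)
  then show ?thesis
    by (simp add: m)
qed

lemma decodable:
  assumes "Z < F" "k < K"
  shows "cond_entropy K N B F S (demanded_file k)
    (\<lambda>\<omega>. (cache K N B F S P k \<omega>, keys K F S P k \<omega>, broadcasts K N B F S P k \<omega>, demanded_perm k \<omega>)) = 0"
  unfolding caching_space_def
proof (rule conditional_entropy_eq_0)
  fix \<omega> \<omega>' assume \<omega>: "\<omega> \<in> outcomes K N B F S" "\<omega>' \<in> outcomes K N B F S"
    and eq: "(cache K N B F S P k \<omega>, keys K F S P k \<omega>, broadcasts K N B F S P k \<omega>, demanded_perm k \<omega>) =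
      (cache K N B F S P k \<omega>', keys K F S P k \<omega>', broadcasts K N B F S P k \<omega>', demanded_perm k \<omega>')"
  obtain W d \<phi> T where 1: "\<omega> = (W, d, \<phi>, T)"
    by (cases \<omega>)
  obtain W' d' \<phi>' T' where 2: "\<omega>' = (W', d', \<phi>', T')"
    by (cases \<omega>')
  have bc: "broadcast K N B F P s \<omega> = broadcast K N B F P s \<omega>'" if "s \<in> multicasts_of K F S P k" for s
    by (rule restrict_eqD[OF _ that]) (use eq in \<open>simp add: broadcasts_def\<close>)
  have T_eq: "T s = T' s" if "s \<in> multicasts_of K F S P k" for s
    by (rule restrict_eqD[OF _ that]) (use eq in \<open>simp add: keys_def 1 2\<close>)
  have "W (d k) = W' (d' k)"
  proof (rule decode[OF assms \<omega>[unfolded 1 2]])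
    show "cache K N B F S P k (W, d, \<phi>, T) = cache K N B F S P k (W', d', \<phi>', T')"
      using eq unfolding 1 2 by (rule Pair_inject)
    show "\<phi> (d k) = \<phi>' (d' k)"
      using eq unfolding 1 2 by (simp add: demanded_perm_def)
  qed (use T_eq bc in \<open>simp_all add: broadcast_def 1 2\<close>)
  then show "demanded_file k \<omega> = demanded_file k \<omega>'"
    by (simp add: demanded_file_def 1 2)
qed

section \<open>Privacy of the demands\<close>

definition reassign :: "(nat \<Rightarrow> nat \<Rightarrow> nat) \<Rightarrow> (nat \<Rightarrow> nat) \<Rightarrow> outcome \<Rightarrow> outcome" where
  "reassign \<rho> d' = (\<lambda>(W, d, \<phi>, T).
    (\<lambda>n\<in>{..<N}. rearrange (\<rho> n) (W n), d', \<lambda>n\<in>{..<N}. \<phi> n \<circ> \<rho> n, T))"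

text \<open>Row \<open>j\<close> of the new file \<open>n\<close> carries the label and content of
  the old row \<open>\<rho> n j\<close>. As \<open>\<rho> n\<close> permutes the cached rows, the
  cache as a set is the same; as it takes each new sent row to the old one, so are the messages. The
  second outcome certifies that \<open>d'\<close> is an admissible demand vector.\<close>

lemma
  assumes \<omega>: "(W, d, \<phi>, T) \<in> outcomes K N B F S" and \<omega>': "(W', d', \<phi>', T') \<in> outcomes K N B F S"
    and k: "k < K" and d_k: "d' k = d k"
    and \<rho>: "\<And>n. \<rho> n permutes cached_rows k"
    and \<rho>_sent: "\<And>n s. s \<in> multicasts_of K F S P k \<Longrightarrow> \<rho> n (sent_row s d' n) = sent_row s d n"
    and \<rho>_k: "\<rho> (d k) = id"
  shows reassign_in_outcomes: "reassign \<rho> d' (W, d, \<phi>, T) \<in> outcomes K N B F S"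
    and cache_reassign:
      "cache K N B F S P k (reassign \<rho> d' (W, d, \<phi>, T)) = cache K N B F S P k (W, d, \<phi>, T)"
    and demanded_perm_reassign:
      "demanded_perm k (reassign \<rho> d' (W, d, \<phi>, T)) = demanded_perm k (W, d, \<phi>, T)"
    and plain_messages_reassign:
      "plain_messages K N B F S P k (reassign \<rho> d' (W, d, \<phi>, T)) =
        plain_messages K N B F S P k (W, d, \<phi>, T)"
proof -
  note D = outcomesD[OF \<omega>] and D' = outcomesD[OF \<omega>']
  have \<rho>F: "\<rho> n permutes {..<F}" for n
    by (rule permutes_subset[OF \<rho>]) (auto simp: cached_rows_def)
  have packet: "packet B F (rearrange (\<rho> n) (W n)) j = packet B F (W n) (\<rho> n j)"
    if "n < N" "j < F" for n j
    using packet_rearrange[OF \<rho>F] D(1) that by simp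
  show *: "reassign \<rho> d' (W, d, \<phi>, T) \<in> outcomes K N B F S"
    using \<omega> \<omega>' permutes_compose[OF \<rho>F D(4)]
    by (auto simp: reassign_def outcomes_iff bit_strings_def length_rearrange)
  have "cached_rows k = \<rho> n ` cached_rows k" for n
    by (rule permutes_image[OF \<rho>, symmetric])
  then have "(\<lambda>j. (n, \<phi> n j, packet B F (W n) j)) ` cached_rows k =
      (\<lambda>j. (n, \<phi> n (\<rho> n j), packet B F (W n) (\<rho> n j))) ` cached_rows k" for n
    by (metis (no_types, lifting) image_image image_cong)
  moreover have "(\<lambda>j. (n, \<phi> n (\<rho> n j), packet B F (rearrange (\<rho> n) (W n)) j)) ` cached_rows k =
      (\<lambda>j. (n, \<phi> n (\<rho> n j), packet B F (W n) (\<rho> n j))) ` cached_rows k" if "n < N" for n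
    by (rule image_cong) (use packet that in \<open>auto simp: cached_rows_def\<close>)
  moreover have "(\<lambda>(n, j). f n j) ` ({..<N} \<times> cached_rows k) = (\<Union>n<N. f n ` cached_rows k)"
    for f :: "nat \<Rightarrow> nat \<Rightarrow> labelled_packet"
    by auto
  ultimately show "cache K N B F S P k (reassign \<rho> d' (W, d, \<phi>, T)) = cache K N B F S P k (W, d, \<phi>, T)"
    unfolding reassign_def prod.case cache_eq[OF k] by simp
  show "demanded_perm k (reassign \<rho> d' (W, d, \<phi>, T)) = demanded_perm k (W, d, \<phi>, T)"
    using D(2)[OF k] by (simp add: demanded_perm_def reassign_def d_k \<rho>_k)
  have "plain_message K N B F P s (reassign \<rho> d' (W, d, \<phi>, T)) = plain_message K N B F P s (W, d, \<phi>, T)"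
    if s: "s \<in> multicasts_of K F S P k" for s
  proof -
    have sS: "s < S"
      using s by (simp add: in_multicasts_of)
    note reassigned = *[unfolded reassign_def prod.case]
    have "(\<lambda>n. (n, (\<lambda>n\<in>{..<N}. \<phi> n \<circ> \<rho> n) n (sent_row s d' n))) ` {..<N} =
        (\<lambda>n. (n, \<phi> n (sent_row s d n))) ` {..<N}"
      by (rule image_cong) (simp_all add: \<rho>_sent[OF s])
    moreover have "xor_family b (\<lambda>n. packet B F ((\<lambda>n\<in>{..<N}. rearrange (\<rho> n) (W n)) n) (sent_row s d' n)) {..<N}
        = xor_family b (\<lambda>n. packet B F (W n) (sent_row s d n)) {..<N}"
      unfolding xor_family_def
      by (intro map_cong sum.cong refl) (simp add: packet sent_row_less[OF D'(3) sS] \<rho>_sent[OF s])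
    ultimately show ?thesis
      unfolding plain_message_def reassign_def prod.case header_eq[OF reassigned sS] header_eq[OF \<omega> sS]
        payload_eq[OF reassigned sS] payload_eq[OF \<omega> sS] by (simp only:)
  qed
  then show "plain_messages K N B F S P k (reassign \<rho> d' (W, d, \<phi>, T)) =
      plain_messages K N B F S P k (W, d, \<phi>, T)"
    unfolding plain_messages_def by (rule restrict_ext)
qed

text \<open>\<open>reassign\<close> forgets the old demands, hence the restriction to one demand
  vector \<open>d\<close>; files and permutations are recovered by undoing each
  \<open>\<rho> n\<close>.\<close>

lemma inj_on_reassign:
  assumes \<rho>: "\<And>n. \<rho> n permutes {..<F}"
  shows "inj_on (reassign \<rho> d') {(W, e, \<phi>, T) \<in> outcomes K N B F S. e = d}"
proof (rule inj_onI)
  fix \<eta> \<eta>' assume "\<eta> \<in> {(W, e, \<phi>, T) \<in> outcomes K N B F S. e = d}"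
    "\<eta>' \<in> {(W, e, \<phi>, T) \<in> outcomes K N B F S. e = d}"
    and reassign_eq: "reassign \<rho> d' \<eta> = reassign \<rho> d' \<eta>'"
  then obtain W \<phi> T W' \<phi>' T' where \<eta>: "\<eta> = (W, d, \<phi>, T)" "\<eta>' = (W', d, \<phi>', T')"
    and \<omega>: "(W, d, \<phi>, T) \<in> outcomes K N B F S" "(W', d, \<phi>', T') \<in> outcomes K N B F S"
    by auto
  note eq = reassign_eq[unfolded \<eta>]
  have W: "rearrange (\<rho> n) (W n) = rearrange (\<rho> n) (W' n)" if "n \<in> {..<N}" for n
    by (rule restrict_eqD[OF _ that]) (use eq in \<open>simp add: reassign_def del: comp_apply\<close>)
  have \<phi>: "\<phi> n \<circ> \<rho> n = \<phi>' n \<circ> \<rho> n" if "n \<in> {..<N}" for n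
    using eq restrict_eqD[of "\<lambda>n. \<phi> n \<circ> \<rho> n" "{..<N}" "\<lambda>n. \<phi>' n \<circ> \<rho> n", OF _ that]
    by (simp add: reassign_def)
  have "W = W'"
  proof (rule PiE_ext)
    show "W \<in> {..<N} \<rightarrow>\<^sub>E bit_strings B" "W' \<in> {..<N} \<rightarrow>\<^sub>E bit_strings B"
      using \<omega> outcomes_iff by blast+
    show "W n = W' n" if "n \<in> {..<N}" for n
      using rearrange_inject[OF \<rho> _ _ W[OF that]] outcomesD(1)[OF \<omega>(1)] outcomesD(1)[OF \<omega>(2)] that
      by simp
  qed
  moreover have "\<phi> = \<phi>'"
  proof (rule PiE_ext)
    show "\<phi> \<in> {..<N} \<rightarrow>\<^sub>E {\<pi>. \<pi> permutes {..<F}}" "\<phi>' \<in> {..<N} \<rightarrow>\<^sub>E {\<pi>. \<pi> permutes {..<F}}"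
      using \<omega> outcomes_iff by blast+
    show "\<phi> n = \<phi>' n" if "n \<in> {..<N}" for n
      using surj_fun_eq[OF permutes_surj[OF \<rho>]] fun_cong[OF \<phi>[OF that]] by (simp add: comp_def) blast
  qed
  moreover have "T = T'"
    using eq by (simp add: reassign_def)
  ultimately show "\<eta> = \<eta>'"
    by (simp add: \<eta>)
qed

text \<open>The transport is \<open>reassign\<close>, with \<open>\<rho>\<close> chosen from the
  demand vectors of \<open>\<omega>\<close> and \<open>\<omega>'\<close> alone, so that one map
  serves the whole class of outcomes.\<close>

lemma demands_private:
  assumes k: "k < K"
  shows "cond_mutual_info K N B F S (other_demands K k) (plain_messages K N B F S P k)
    (\<lambda>\<omega>. (demanded_perm k \<omega>, cache K N B F S P k \<omega>, demand k \<omega>, user_groups K F S P k)) = 0"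
  unfolding caching_space_def
proof (rule conditional_mutual_information_eq_0)
  let ?X = "other_demands K k" and ?Y = "plain_messages K N B F S P k"
    and ?Z = "\<lambda>\<omega>. (demanded_perm k \<omega>, cache K N B F S P k \<omega>, demand k \<omega>, user_groups K F S P k)"
  fix \<omega> \<omega>' assume \<omega>: "\<omega> \<in> outcomes K N B F S" "\<omega>' \<in> outcomes K N B F S" and Z: "?Z \<omega> = ?Z \<omega>'"
  obtain W d \<phi> T where 1: "\<omega> = (W, d, \<phi>, T)"
    by (cases \<omega>)
  obtain W' d' \<phi>' T' where 2: "\<omega>' = (W', d', \<phi>', T')"
    by (cases \<omega>')
  note D = outcomesD[OF \<omega>(1)[unfolded 1]] and D' = outcomesD[OF \<omega>(2)[unfolded 2]]
  have d_k: "d' k = d k"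
    using Z by (simp add: 1 2 demand_def)
  have "\<exists>r. r permutes cached_rows k \<and>
      (\<forall>s\<in>multicasts_of K F S P k. r (sent_row s d' n) = sent_row s d n) \<and> (n = d k \<longrightarrow> r = id)" for n
  proof (cases "n = d k")
    case True
    \<comment> \<open>For the file of \<open>k\<close> itself both rows are the wanted row of
      \<open>k\<close>, so the identity is available, as is needed to keep
      \<open>\<phi> (d k)\<close>.\<close>
    have "sent_row s d' n = sent_row s d n" if "s \<in> multicasts_of K F S P k" for s
      using that True d_k sent_row_demand[OF inj_on_U[OF D(3)], of k s]
        sent_row_demand[OF inj_on_U[OF D'(3)], of k s] by (simp add: in_multicasts_of)
    then show ?thesis
      by (intro exI[of _ id]) (simp add: permutes_id)
  next
    case False
    \<comment> \<open>For any other file, the rows sent under \<open>d'\<close> and under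
      \<open>d\<close> are two injective families of cached rows indexed by the messages.\<close>
    obtain r where "r permutes cached_rows k"
      "\<And>s. s \<in> multicasts_of K F S P k \<Longrightarrow> r (sent_row s d' n) = sent_row s d n"
      using permutation_extending[OF finite_cached_rows inj_on_sent_row[OF D'(3)] inj_on_sent_row[OF D(3)]]
        sent_row_cached[OF D'(3)] sent_row_cached[OF D(3)] False d_k
      by (metis (no_types, lifting) image_subsetI)
    with False show ?thesis
      by blast
  qed
  then obtain \<rho> where \<rho>: "\<And>n. \<rho> n permutes cached_rows k"
    and \<rho>_sent: "\<And>n s. s \<in> multicasts_of K F S P k \<Longrightarrow> \<rho> n (sent_row s d' n) = sent_row s d n"
    and \<rho>_k: "\<rho> (d k) = id"
    by metis
  have \<rho>F: "\<rho> n permutes {..<F}" for n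
    by (rule permutes_subset[OF \<rho>]) (auto simp: cached_rows_def)
  \<comment> \<open>\<open>?X\<close> gives the demands of the other users and \<open>?Z\<close>
    that of \<open>k\<close>, so the class to be transported has the single demand vector
    \<open>d\<close>.\<close>
  have d_eq: "e = d" if \<eta>: "(V, e, \<psi>, R) \<in> outcomes K N B F S"
    and X: "?X (V, e, \<psi>, R) = ?X \<omega>" and Z: "?Z (V, e, \<psi>, R) = ?Z \<omega>" for V e \<psi> R
  proof (rule PiE_ext)
    show "e \<in> {..<K} \<rightarrow>\<^sub>E {..<N}" "d \<in> {..<K} \<rightarrow>\<^sub>E {..<N}"
      using \<eta> \<omega> 1 outcomes_iff by blast+
    fix i assume i: "i \<in> {..<K}"
    have "restrict e ({..<K} - {k}) = restrict d ({..<K} - {k})"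
      using X by (simp add: other_demands_def 1)
    moreover have "e k = d k"
      using Z by (simp add: demand_def 1)
    ultimately show "e i = d i"
      using i restrict_eqD[of e "{..<K} - {k}" d i] by (cases "i = k") auto
  qed
  show "\<exists>f. inj_on f {\<eta> \<in> outcomes K N B F S. ?X \<eta> = ?X \<omega> \<and> ?Z \<eta> = ?Z \<omega>} \<and>
      (\<forall>\<eta> \<in> outcomes K N B F S. ?X \<eta> = ?X \<omega> \<and> ?Z \<eta> = ?Z \<omega> \<longrightarrow>
        f \<eta> \<in> outcomes K N B F S \<and> ?X (f \<eta>) = ?X \<omega>' \<and> ?Y (f \<eta>) = ?Y \<eta> \<and> ?Z (f \<eta>) = ?Z \<omega>)"
  proof (intro exI[of _ "reassign \<rho> d'"] conjI ballI impI)
    show "inj_on (reassign \<rho> d') {\<eta> \<in> outcomes K N B F S. ?X \<eta> = ?X \<omega> \<and> ?Z \<eta> = ?Z \<omega>}"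
    proof (rule inj_on_subset)
      show "inj_on (reassign \<rho> d') {(V, e, \<psi>, R) \<in> outcomes K N B F S. e = d}"
        by (rule inj_on_reassign[OF \<rho>F])
    qed (use d_eq in auto)
    fix \<eta> assume \<eta>: "\<eta> \<in> outcomes K N B F S" and XZ: "?X \<eta> = ?X \<omega> \<and> ?Z \<eta> = ?Z \<omega>"
    obtain V \<psi> R where 3: "\<eta> = (V, d, \<psi>, R)"
      using d_eq \<eta> XZ by (cases \<eta>) blast
    note reassign = \<eta>[unfolded 3] \<omega>(2)[unfolded 2] k d_k \<rho> \<rho>_sent \<rho>_k
    show "reassign \<rho> d' \<eta> \<in> outcomes K N B F S"
      unfolding 3 by (rule reassign_in_outcomes[OF reassign])
    show "?X (reassign \<rho> d' \<eta>) = ?X \<omega>'"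
      by (simp add: other_demands_def reassign_def 2 3)
    show "?Y (reassign \<rho> d' \<eta>) = ?Y \<eta>"
      unfolding 3 by (rule plain_messages_reassign[OF reassign])
    have "demand k (reassign \<rho> d' \<eta>) = demand k \<eta>"
      by (simp add: demand_def reassign_def 3 d_k)
    moreover have "cache K N B F S P k (reassign \<rho> d' \<eta>) = cache K N B F S P k \<eta>"
      unfolding 3 by (rule cache_reassign[OF reassign])
    moreover have "demanded_perm k (reassign \<rho> d' \<eta>) = demanded_perm k \<eta>"
      unfolding 3 by (rule demanded_perm_reassign[OF reassign])
    ultimately show "?Z (reassign \<rho> d' \<eta>) = ?Z \<omega>"
      using XZ by simp
  qed
qed

lemma gives_scheme_of_spda:
  assumes "Z < F"
  shows "gives_scheme K N B F S P (real N * real (F + Z) / real (2 * F)) (real S / real F)"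
  unfolding gives_scheme_def secure_coded_caching_def
  using decodable[OF assms] demands_private memory rate by blast

end

section \<open>The array of subsets\<close>

text \<open>\<open>R\<close> and \<open>\<beta>\<close> are arbitrary numberings of the subsets;
  they supply the integer rows and symbols that an array requires.\<close>

locale subset_array =
  fixes K t :: nat and R :: "nat \<Rightarrow> nat set" and \<beta> :: "nat \<Rightarrow> nat set"
  assumes t: "0 < t" "t < K"
    and R: "bij_betw R {..<(K choose t) + (K choose Suc t)}
      {A. A \<subseteq> {..<K} \<and> (card A = t \<or> card A = Suc t)}"
    and \<beta>: "bij_betw \<beta> {..<K choose Suc t} {A. A \<subseteq> {..<K} \<and> card A = Suc t}"
begin

abbreviation "F \<equiv> (K choose t) + (K choose Suc t)"
abbreviation "S \<equiv> K choose Suc t"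
abbreviation "Z \<equiv> ((K - 1) choose (t - 1)) + ((K - 1) choose Suc t)"

definition symbol :: "nat set \<Rightarrow> nat" where
  "symbol = the_inv_into {..<S} \<beta>"

definition row_index :: "nat set \<Rightarrow> nat" where
  "row_index = the_inv_into {..<F} R"

definition P :: pd_array where
  "P j k = (if card (R j) = t then if k \<in> R j then None else Some (symbol (insert k (R j)))
    else if k \<in> R j then Some (symbol (R j)) else None)"

section \<open>Numbering of rows and symbols\<close>

lemma
  assumes "s < S"
  shows \<beta>_subset: "\<beta> s \<subseteq> {..<K}" and card_\<beta>: "card (\<beta> s) = Suc t" and finite_\<beta>: "finite (\<beta> s)"
    and symbol_\<beta>: "symbol (\<beta> s) = s"
proof -
  have "\<beta> s \<in> {A. A \<subseteq> {..<K} \<and> card A = Suc t}"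
    using bij_betwE[OF \<beta>] assms by blast
  then show "\<beta> s \<subseteq> {..<K}" "card (\<beta> s) = Suc t" "finite (\<beta> s)"
    by (auto intro: finite_subset)
  show "symbol (\<beta> s) = s"
    unfolding symbol_def using \<beta> assms by (simp add: bij_betw_def the_inv_into_f_f)
qed

lemma
  assumes "A \<subseteq> {..<K}" "card A = Suc t"
  shows \<beta>_symbol: "\<beta> (symbol A) = A" and symbol_less: "symbol A < S"
  using assms f_the_inv_into_f_bij_betw[OF \<beta>, of A] bij_betwE[OF bij_betw_the_inv_into[OF \<beta>]]
  by (auto simp: symbol_def)

lemma
  assumes "j < F"
  shows R_subset: "R j \<subseteq> {..<K}" and card_R: "card (R j) = t \<or> card (R j) = Suc t"
    and finite_R: "finite (R j)" and row_R: "row_index (R j) = j"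
proof -
  have "R j \<in> {A. A \<subseteq> {..<K} \<and> (card A = t \<or> card A = Suc t)}"
    using bij_betwE[OF R] assms by blast
  then show "R j \<subseteq> {..<K}" "card (R j) = t \<or> card (R j) = Suc t" "finite (R j)"
    by (auto intro: finite_subset)
  show "row_index (R j) = j"
    unfolding row_index_def using R assms by (simp add: bij_betw_def the_inv_into_f_f)
qed

lemma
  assumes "A \<subseteq> {..<K}" "card A = t \<or> card A = Suc t"
  shows R_row: "R (row_index A) = A" and row_less: "row_index A < F"
  using assms f_the_inv_into_f_bij_betw[OF R, of A] bij_betwE[OF bij_betw_the_inv_into[OF R]]
  by (auto simp: row_index_def)

lemma P_None: "j < F \<Longrightarrow> P j k = None \<longleftrightarrow> (k \<in> R j \<longleftrightarrow> card (R j) = t)"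
  using card_R[of j] by (auto simp: P_def)

text \<open>Reads the array backwards: the two alternatives are the main row and the diagonal row of
  column \<open>k\<close>. The row sizes \<open>t + 1\<close> and \<open>t\<close> keep them
  apart.\<close>

lemma P_Some:
  assumes "j < F" "k < K" "s < S"
  shows "P j k = Some s \<longleftrightarrow> k \<in> \<beta> s \<and> (R j = \<beta> s \<or> R j = \<beta> s - {k})"
proof (cases "card (R j) = t")
  case True
  have "R j \<noteq> \<beta> s"
    using True card_\<beta>[OF assms(3)] by auto
  moreover have "P j k = Some s \<longleftrightarrow> k \<in> \<beta> s \<and> R j = \<beta> s - {k}"
  proof (cases "k \<in> R j")
    case False
    then have "insert k (R j) \<subseteq> {..<K}" "card (insert k (R j)) = Suc t"
      using assms True R_subset finite_R by auto
    then have "symbol (insert k (R j)) = s \<longleftrightarrow> insert k (R j) = \<beta> s"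
      using \<beta>_symbol symbol_\<beta>[OF assms(3)] by metis
    then show ?thesis
      using True False by (auto simp: P_def)
  qed (use True in \<open>auto simp: P_def\<close>)
  ultimately show ?thesis by blast
next
  case False
  then have card: "card (R j) = Suc t"
    using card_R assms by blast
  then have "symbol (R j) = s \<longleftrightarrow> R j = \<beta> s"
    using \<beta>_symbol symbol_\<beta>[OF assms(3)] R_subset[OF assms(1)] by metis
  moreover have "R j \<noteq> \<beta> s - {k}" if "k \<in> \<beta> s"
  proof
    assume "R j = \<beta> s - {k}"
    then have "card (R j) = t"
      using that card_\<beta>[OF assms(3)] by simp
    then show False
      using False by simp
  qed
  ultimately show ?thesis
    using False by (auto simp: P_def)
qed

lemma P_less: "j < F \<Longrightarrow> k < K \<Longrightarrow> P j k = Some s \<Longrightarrow> s < S"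
  using card_R[of j] symbol_less[of "insert k (R j)"] symbol_less[of "R j"] R_subset[of j] finite_R[of j]
  by (simp add: P_def split: if_splits)

section \<open>The subarray of a symbol in the array of subsets\<close>

lemma
  assumes "s < S"
  shows R_row_\<beta>: "R (row_index (\<beta> s)) = \<beta> s" and row_\<beta>_less: "row_index (\<beta> s) < F"
    and R_row_\<beta>_minus: "k \<in> \<beta> s \<Longrightarrow> R (row_index (\<beta> s - {k})) = \<beta> s - {k}"
    and row_\<beta>_minus_less: "k \<in> \<beta> s \<Longrightarrow> row_index (\<beta> s - {k}) < F"
  using \<beta>_subset[OF assms] card_\<beta>[OF assms] finite_\<beta>[OF assms]
  by (auto intro!: R_row row_less)

lemma users_P:
  assumes "s < S"
  shows "users K F P s = \<beta> s"
proof (intro equalityI subsetI)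
  fix k assume "k \<in> users K F P s"
  then show "k \<in> \<beta> s"
    using P_Some assms by (auto simp: users_def)
next
  fix k assume "k \<in> \<beta> s"
  then have "k < K" "P (row_index (\<beta> s)) k = Some s"
    using P_Some[OF row_\<beta>_less[OF assms] _ assms, of k] R_row_\<beta>[OF assms] \<beta>_subset[OF assms] by auto
  then show "k \<in> users K F P s"
    using row_\<beta>_less[OF assms] by (auto simp: users_def)
qed

lemma rows_with_P:
  assumes "s < S"
  shows "rows_with K F P s = insert (row_index (\<beta> s)) ((\<lambda>k. row_index (\<beta> s - {k})) ` \<beta> s)"
proof (intro equalityI subsetI)
  fix j assume "j \<in> rows_with K F P s"
  then obtain k where j: "j < F" "k < K" "P j k = Some s"
    by (auto simp: rows_with_def)
  then show "j \<in> insert (row_index (\<beta> s)) ((\<lambda>k. row_index (\<beta> s - {k})) ` \<beta> s)"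
    using P_Some[OF j(1,2) assms] row_R[OF j(1)] by auto
next
  obtain k where "k \<in> \<beta> s"
    using card_\<beta>[OF assms] by fastforce
  fix j assume "j \<in> insert (row_index (\<beta> s)) ((\<lambda>k. row_index (\<beta> s - {k})) ` \<beta> s)"
  then obtain k where k: "k \<in> \<beta> s" "j = row_index (\<beta> s) \<or> j = row_index (\<beta> s - {k})"
    using \<open>k \<in> \<beta> s\<close> by blast
  then have "j < F" "k < K" "R j = \<beta> s \<or> R j = \<beta> s - {k}"
    using \<beta>_subset[OF assms] R_row_\<beta>[OF assms] row_\<beta>_less[OF assms] R_row_\<beta>_minus[OF assms]
      row_\<beta>_minus_less[OF assms] by auto
  then show "j \<in> rows_with K F P s"
    using P_Some[of j k s] k assms by (auto simp: rows_with_def)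
qed

text \<open>Here g is \<open>t + 1\<close>; the full row is the one of \<open>\<beta> s\<close>, and
  the diagonal row of column \<open>k\<close> is the one of \<open>\<beta> s - {k}\<close>.\<close>

lemma subarray:
  assumes "s < S"
  shows "\<exists>(g::nat) r c.
    bij_betw r {..<g + 1} (rows_with K F P s) \<and> bij_betw c {..<g} (users K F P s) \<and>
    (\<forall>l<g. P (r 0) (c l) = Some s) \<and>
    (\<forall>i<g. \<forall>l<g. P (r (i + 1)) (c l) = (if i = l then Some s else None))"
proof -
  note \<beta>s = \<beta>_subset[OF assms] card_\<beta>[OF assms] finite_\<beta>[OF assms]
  obtain c where c: "bij_betw c {..<Suc t} (\<beta> s)"
    using ex_bij_betw_nat_finite[OF \<beta>s(3)] \<beta>s(2) by (auto simp: atLeast0LessThan)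
  have c_mem: "c l \<in> \<beta> s" "c l < K" if "l < Suc t" for l
    using bij_betwE[OF c] that \<beta>s(1) by auto
  have c_inj: "c i = c l \<longleftrightarrow> i = l" if "i < Suc t" "l < Suc t" for i l
    using c that by (auto simp: bij_betw_def inj_on_def)
  define r where "r i = row_index (case i of 0 \<Rightarrow> \<beta> s | Suc l \<Rightarrow> \<beta> s - {c l})" for i
  have R_r: "R (r 0) = \<beta> s" "\<And>l. l < Suc t \<Longrightarrow> R (r (Suc l)) = \<beta> s - {c l}"
    using R_row_\<beta>[OF assms] R_row_\<beta>_minus[OF assms c_mem(1)] by (auto simp: r_def)
  have r_less: "r 0 < F" "\<And>l. l < Suc t \<Longrightarrow> r (Suc l) < F"
    using row_\<beta>_less[OF assms] row_\<beta>_minus_less[OF assms c_mem(1)] by (auto simp: r_def)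
  have "inj_on r {..<Suc (Suc t)}"
  proof (rule inj_onI)
    fix i l assume il: "i \<in> {..<Suc (Suc t)}" "l \<in> {..<Suc (Suc t)}" "r i = r l"
    have neq: "\<beta> s \<noteq> \<beta> s - {c a}" if "a < Suc t" for a
      using c_mem(1)[OF that] by blast
    have eq: "a = a'" if "\<beta> s - {c a} = \<beta> s - {c a'}" "a < Suc t" "a' < Suc t" for a a'
      using that c_mem(1) c_inj by blast
    show "i = l"
      using il neq eq R_r by (cases i; cases l) (fastforce dest!: arg_cong[of _ _ R])+
  qed
  moreover have "r ` {..<Suc (Suc t)} = rows_with K F P s"
  proof -
    have "{..<Suc (Suc t)} = insert 0 (Suc ` {..<Suc t})"
      by (simp add: lessThan_Suc_eq_insert_0)
    then have "r ` {..<Suc (Suc t)} = insert (r 0) ((\<lambda>l. r (Suc l)) ` {..<Suc t})"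
      by (simp add: image_image)
    also have "\<dots> = insert (row_index (\<beta> s)) ((\<lambda>k. row_index (\<beta> s - {k})) ` c ` {..<Suc t})"
      by (simp add: r_def image_image)
    finally show ?thesis
      using c unfolding rows_with_P[OF assms] bij_betw_def by simp
  qed
  ultimately have r: "bij_betw r {..<Suc t + 1} (rows_with K F P s)"
    by (simp add: bij_betw_def)
  have main: "P (r 0) (c l) = Some s" if "l < Suc t" for l
    using P_Some[OF r_less(1) c_mem(2)[OF that] assms] R_r(1) c_mem(1)[OF that] by simp
  have diag: "P (r (i + 1)) (c l) = (if i = l then Some s else None)" if "i < Suc t" "l < Suc t" for i l
  proof (cases "i = l")
    case True
    then show ?thesis
      using P_Some[OF r_less(2) c_mem(2) assms, of l l] R_r(2) c_mem(1) that by simp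
  next
    case False
    \<comment> \<open>Off the diagonal, the \<open>t\<close>-subset \<open>\<beta> s - {c i}\<close>
      still contains \<open>c l\<close>, which is a case of \<open>*\<close>.\<close>
    have "card (R (r (Suc i))) = t"
      using R_r(2)[OF that(1)] c_mem(1)[OF that(1)] \<beta>s by simp
    moreover have "c l \<in> R (r (Suc i))"
      using False R_r(2)[OF that(1)] c_mem(1)[OF that(2)] c_inj[OF that] by auto
    ultimately show ?thesis
      using P_None[OF r_less(2)[OF that(1)]] False by simp
  qed
  show ?thesis
    unfolding users_P[OF assms]
    by (intro exI[of _ "Suc t"] exI[of _ r] exI[of _ c] conjI allI impI r c main diag)
qed

section \<open>Counting symbols and stars\<close>

lemma four_occurrences:
  assumes "s < S"
  shows "4 \<le> card {(j, k). j < F \<and> k < K \<and> P j k = Some s}"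
proof -
  note \<beta>s = \<beta>_subset[OF assms] card_\<beta>[OF assms] finite_\<beta>[OF assms]
  let ?A = "(\<lambda>k. (row_index (\<beta> s), k)) ` \<beta> s" and ?B = "(\<lambda>k. (row_index (\<beta> s - {k}), k)) ` \<beta> s"
  have "row_index (\<beta> s) \<noteq> row_index (\<beta> s - {k})" if "k \<in> \<beta> s" for k
    using R_row_\<beta>[OF assms] R_row_\<beta>_minus[OF assms that] that by (metis DiffD2 insertI1)
  then have "?A \<inter> ?B = {}"
    by auto
  then have "card (?A \<union> ?B) = Suc t + Suc t"
    using \<beta>s by (subst card_Un_disjoint) (auto simp: card_image inj_on_def)
  \<comment> \<open>\<open>s\<close> occurs \<open>t + 1\<close> times in its main row and once in
    each of \<open>t + 1\<close> diagonal rows; \<open>t > 0\<close> makes this at least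
    four.\<close>
  then have "4 \<le> card (?A \<union> ?B)"
    using t by simp
  also have "\<dots> \<le> card {(j, k). j < F \<and> k < K \<and> P j k = Some s}"
  proof (rule card_mono)
    show "finite {(j, k). j < F \<and> k < K \<and> P j k = Some s}"
      by (rule finite_subset[of _ "{..<F} \<times> {..<K}"]) auto
    show "?A \<union> ?B \<subseteq> {(j, k). j < F \<and> k < K \<and> P j k = Some s}"
      using \<beta>s(1) P_Some[OF _ _ assms] R_row_\<beta>[OF assms] row_\<beta>_less[OF assms]
        R_row_\<beta>_minus[OF assms] row_\<beta>_minus_less[OF assms] by auto
  qed
  finally show ?thesis .
qed

text \<open>The stars of column \<open>k\<close> sit in the \<open>t\<close>-subsets containing
  \<open>k\<close> and in the \<open>(t + 1)\<close>-subsets avoiding it; both are counted by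
  subsets of the other \<open>K - 1\<close> users.\<close>

lemma stars:
  assumes k: "k < K"
  shows "card {j. j < F \<and> P j k = None} = Z"
proof -
  let ?X = "{..<K} - {k}"
  have X: "finite ?X" "card ?X = K - 1"
    using k by auto
  let ?A = "{A. A \<subseteq> {..<K} \<and> card A = t \<and> k \<in> A}" and ?B = "{A. A \<subseteq> ?X \<and> card A = Suc t}"
  have image: "R ` {j. j < F \<and> P j k = None} = ?A \<union> ?B"
  proof (intro equalityI subsetI)
    fix A assume "A \<in> R ` {j. j < F \<and> P j k = None}"
    then obtain j where "A = R j" "j < F" "k \<in> R j \<longleftrightarrow> card (R j) = t"
      using P_None by auto
    then show "A \<in> ?A \<union> ?B"
      using R_subset[of j] card_R[of j] by auto
  next
    fix A assume A: "A \<in> ?A \<union> ?B"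
    then have "A \<subseteq> {..<K}" "card A = t \<or> card A = Suc t" "k \<in> A \<longleftrightarrow> card A = t"
      by auto
    then show "A \<in> R ` {j. j < F \<and> P j k = None}"
      using R_row[of A] row_less[of A] P_None[of "row_index A" k] by (intro image_eqI[of _ _ "row_index A"]) auto
  qed
  have "inj_on R {j. j < F \<and> P j k = None}"
    by (rule inj_on_subset[OF bij_betw_imp_inj_on[OF R]]) auto
  then have "card {j. j < F \<and> P j k = None} = card (?A \<union> ?B)"
    unfolding image[symmetric] by (rule card_image[symmetric])
  also have "\<dots> = card ?A + card ?B"
    by (rule card_Un_disjoint) (auto intro: finite_subset[of _ "Pow {..<K}"])
  \<comment> \<open>Deleting \<open>k\<close> is inverse to inserting it; \<open>t > 0\<close> keeps
    \<open>t - 1\<close> from being truncated.\<close>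
  also have "?A = insert k ` {A. A \<subseteq> ?X \<and> card A = t - 1}"
  proof (intro equalityI subsetI)
    fix A assume A: "A \<in> ?A"
    then have "finite A"
      by (auto intro: finite_subset)
    with A show "A \<in> insert k ` {A. A \<subseteq> ?X \<and> card A = t - 1}"
      by (intro image_eqI[of _ _ "A - {k}"]) auto
  next
    fix A assume "A \<in> insert k ` {A. A \<subseteq> ?X \<and> card A = t - 1}"
    then obtain A' where A': "A = insert k A'" "A' \<subseteq> ?X" "card A' = t - 1"
      by blast
    then have "finite A'" "k \<notin> A'"
      by (auto intro: finite_subset)
    with A' show "A \<in> ?A"
      using t k by auto
  qed
  also have "card (insert k ` {A. A \<subseteq> ?X \<and> card A = t - 1}) = card {A. A \<subseteq> ?X \<and> card A = t - 1}"
    by (rule card_image) (auto simp: inj_on_def)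
  also have "\<dots> = (K - 1) choose (t - 1)"
    using n_subsets[OF X(1)] X(2) by simp
  also have "card ?B = (K - 1) choose Suc t"
    using n_subsets[OF X(1)] X(2) by simp
  finally show ?thesis .
qed

lemma spda: "spda K F Z S P"
  unfolding spda_def using t P_less stars four_occurrences subarray by auto

end

section \<open>Existence of the array and its numerical parameters\<close>

lemma ex_spda:
  fixes K t :: nat
  assumes t: "0 < t" "t < K"
  shows "\<exists>P. spda K ((K choose t) + (K choose Suc t))
    (((K - 1) choose (t - 1)) + ((K - 1) choose Suc t)) (K choose Suc t) P"
proof -
  have fin: "finite {A. A \<subseteq> {..<K} \<and> Q A}" for Q
    by (rule finite_subset[of _ "Pow {..<K}"]) auto
  have "{A. A \<subseteq> {..<K} \<and> (card A = t \<or> card A = Suc t)} =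
      {A. A \<subseteq> {..<K} \<and> card A = t} \<union> {A. A \<subseteq> {..<K} \<and> card A = Suc t}"
    by auto
  then have "card {A. A \<subseteq> {..<K} \<and> (card A = t \<or> card A = Suc t)} = (K choose t) + (K choose Suc t)"
    using fin by (simp add: card_Un_disjoint disjoint_iff n_subsets)
  then obtain R where R: "bij_betw R {..<(K choose t) + (K choose Suc t)}
      {A. A \<subseteq> {..<K} \<and> (card A = t \<or> card A = Suc t)}"
    using ex_bij_betw_nat_finite[OF fin] by (metis atLeast0LessThan)
  obtain \<beta> where \<beta>: "bij_betw \<beta> {..<K choose Suc t} {A. A \<subseteq> {..<K} \<and> card A = Suc t}"
    using ex_bij_betw_nat_finite[OF fin] by (metis atLeast0LessThan card_lessThan finite_lessThan n_subsets)
  interpret subset_array K t R \<beta>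
    by standard (use t R \<beta> in auto)
  show ?thesis
    using spda by blast
qed

text \<open>By Pascal's rule \<open>F\<close> is K + 1 choose t + 1, and \<open>F\<close> exceeds
  \<open>Z\<close> by 2c, where c is K - 1 choose t. Absorption identities relate both to K choose
  t, so c / F = (K - t)(t + 1) / (K (K + 1)), while (F + Z) / (2 F) = 1 - c / F.\<close>

lemma subset_array_fractions:
  fixes K t :: nat
  assumes "0 < t" "t < K"
  defines "F \<equiv> (K choose t) + (K choose (t + 1))"
  defines "Z \<equiv> ((K - 1) choose (t - 1)) + ((K - 1) choose (t + 1))"
  shows "Z < F"
    and "real (F + Z) / real (2 * F) = 1 - real ((K - t) * (t + 1)) / real (K * (K + 1))"
    and "real (K choose (t + 1)) / real F = real (K - t) / real (K + 1)"
proof -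
  define c where "c = (K - 1) choose t"
  obtain K' t' where Suc: "K = Suc K'" "t = Suc t'"
    using assms(1,2) by (metis gr0_conv_Suc less_trans)
  have F: "F = Suc K choose Suc t"
    by (simp add: F_def)
  have Z: "F = Z + 2 * c"
    by (simp add: F_def Z_def c_def Suc)
  have "0 < c"
    using assms(1,2) by (simp add: c_def zero_less_binomial_iff)
  then show "Z < F"
    using Z by simp
  have "(K - t) * (K choose t) = K * c"
    using binomial_absorb_comp[of K t] by (simp add: c_def)
  moreover have "(t + 1) * F = (K + 1) * (K choose t)"
    using Suc_times_binomial[of t K] by (simp add: F)
  ultimately have cF: "(K - t) * (t + 1) * F = K * (K + 1) * c"
    by (metis mult.assoc mult.commute)
  have "(t + 1) * (K choose (t + 1)) = K * c"
    using binomial_absorption[of t K] by (simp add: c_def)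
  \<comment> \<open>Both sides keep the factor \<open>t + 1\<close> so that no division of natural
    numbers occurs; it is cancelled next.\<close>
  then have "(t + 1) * ((K choose (t + 1)) * (K + 1)) = (t + 1) * ((K - t) * F)"
    using cF by (metis mult.assoc mult.commute)
  then have S: "(K choose (t + 1)) * (K + 1) = (K - t) * F"
    by (metis add_is_0 mult_cancel1 one_neq_zero)
  have F_pos: "0 < F" and K_pos: "0 < K"
    using \<open>Z < F\<close> assms(2) by simp_all
  have "real ((K - t) * (t + 1)) * real F = real (K * (K + 1)) * real c"
    using arg_cong[OF cF, of real] by (simp only: of_nat_mult)
  then have "real ((K - t) * (t + 1)) / real (K * (K + 1)) = real c / real F"
    using F_pos K_pos by (subst frac_eq_eq) (simp_all add: mult.commute del: of_nat_mult of_nat_add)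
  moreover have "real (F + Z) = real (2 * F) - 2 * real c"
    using Z by simp
  ultimately show "real (F + Z) / real (2 * F) = 1 - real ((K - t) * (t + 1)) / real (K * (K + 1))"
    using F_pos by (simp add: diff_divide_distrib)
  have "real (K choose (t + 1)) * real (K + 1) = real (K - t) * real F"
    using arg_cong[OF S, of real] by (simp only: of_nat_mult)
  then show "real (K choose (t + 1)) / real F = real (K - t) / real (K + 1)"
    using F_pos by (subst frac_eq_eq) (simp_all del: of_nat_add)
qed

theorem theorem5:
  fixes K t :: nat
  assumes "0 < K" and "0 < t" and "t < K"
    and "\<not> (t + 1) dvd K"
    and "\<lfloor>real K / 2\<rfloor> < int (t + 1)"
  shows "\<exists>P F Z S.
     F = (K choose t) + (K choose (t + 1)) \<and>
     Z = ((K - 1) choose (t - 1)) + ((K - 1) choose (t + 1)) \<and>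
     S = K choose (t + 1) \<and>
     spda K F Z S P \<and>
     (\<forall>N B. K \<le> N \<longrightarrow> 0 < B \<longrightarrow> F dvd B \<longrightarrow>
        (\<exists>M R. gives_scheme K N B F S P M R \<and>
           M / real N = 1 - real ((K - t) * (t + 1)) / real (K * (K + 1)) \<and>
           R = real (K - t) / real (K + 1)))"
proof -
  define F Z S where "F = (K choose t) + (K choose (t + 1))"
    and "Z = ((K - 1) choose (t - 1)) + ((K - 1) choose (t + 1))" and "S = K choose (t + 1)"
  note fractions = subset_array_fractions[OF assms(2,3), folded F_def Z_def S_def]
  obtain P where P: "spda K F Z S P"
    using ex_spda[OF assms(2,3)] by (auto simp: F_def Z_def S_def)
  have "\<exists>M R. gives_scheme K N B F S P M R \<and>
      M / real N = 1 - real ((K - t) * (t + 1)) / real (K * (K + 1)) \<and>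
      R = real (K - t) / real (K + 1)" if "K \<le> N" "0 < B" "F dvd B" for N B
  proof -
    interpret spda_scheme K F Z S P N B
      by standard (use P that in auto)
    \<comment> \<open>Cancelling \<open>N\<close> is legitimate because
      \<open>N \<ge> K > 0\<close>.\<close>
    have "real N * real (F + Z) / real (2 * F) / real N = real (F + Z) / real (2 * F)"
      using assms(1) that(1) by simp
    then show ?thesis
      using gives_scheme_of_spda[OF fractions(1)] fractions(2,3) by metis
  qed
  with P show ?thesis
    unfolding F_def Z_def S_def by blast
qed

end
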